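(* There exists a finite generating multiset $S$ of the group $\mathrm{SL}_3(\mathbb{Z})$ such that the Green series $\Gamma_{(\mathrm{SL}_3(\mathbb{Z}),S)}(z)\in\mathbb{Z}[[z]]$ is not $D$-finite.
   Context: Green series: for a group $G$ and a finite generating multiset $S$ of $G$, $\Gamma_{(G,S)}(z)=\sum_{\ell\ge 0}c_\ell z^\ell\in\mathbb{Z}[[z]]$, where $c_\ell=\#\{(s_1,\ldots,s_\ell)\in S^\ell \mid s_1\cdots s_\ell=e_G\}$; here tuples are counted with multiplicity, i.e. different copies of the same element in the multiset $S$ are regarded as distinct choices. $D$-finite: a series $\sum_{n\ge 0}a_n z^n\in\mathbb{Z}[[z]]$ is $D$-finite if there exist polynomials $p_0,\ldots,p_k\in\mathbb{Z}[X]$ with $p_0\neq 0$ such that $p_0(n)a_n+p_1(n)a_{n-1}+\cdots+p_k(n)a_{n-k}=0$ for all $n\ge k$. *)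

theory Defs
  imports
    "HOL-Algebra.Generated_Groups"
    "HOL-Analysis.Determinants"
    "HOL-Computational_Algebra.Formal_Power_Series"
    "HOL-Computational_Algebra.Polynomial"
    "HOL-Library.Multiset"
begin

definition SL :: "('a::comm_ring_1 ^ 'n ^ 'n) monoid" where
  "SL = \<lparr>carrier = {A. det A = 1}, monoid.mult = (**), one = mat 1\<rparr>"

abbreviation SL3Z :: "(int ^ 3 ^ 3) monoid" where
  "SL3Z \<equiv> SL"

lemma group_SL3Z: "group SL3Z"
proof (rule groupI)
  fix A :: "int ^ 3 ^ 3"
  assume "A \<in> carrier SL3Z"
  then have d: "det A = 1" by (simp add: SL_def)
  define B :: "int ^ 3 ^ 3" where "B = vector
    [vector [A$2$2 * A$3$3 - A$2$3 * A$3$2, A$1$3 * A$3$2 - A$1$2 * A$3$3, A$1$2 * A$2$3 - A$1$3 * A$2$2],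
     vector [A$2$3 * A$3$1 - A$2$1 * A$3$3, A$1$1 * A$3$3 - A$1$3 * A$3$1, A$1$3 * A$2$1 - A$1$1 * A$2$3],
     vector [A$2$1 * A$3$2 - A$2$2 * A$3$1, A$1$2 * A$3$1 - A$1$1 * A$3$2, A$1$1 * A$2$2 - A$1$2 * A$2$1]]"
  have BA: "B ** A = mat 1"
    using d unfolding B_def det_3
    by (simp add: vec_eq_iff matrix_matrix_mult_def mat_def sum_3 forall_3 vector_3 algebra_simps)
  have "det B = 1"
    using det_mul[of B A] d by (simp add: BA)
  with BA show "\<exists>B\<in>carrier SL3Z. B \<otimes>\<^bsub>SL3Z\<^esub> A = \<one>\<^bsub>SL3Z\<^esub>"
    by (auto simp: SL_def)
qed (auto simp: SL_def det_mul matrix_mul_assoc)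

definition generating_mset :: "('a, 'b) monoid_scheme \<Rightarrow> 'a multiset \<Rightarrow> bool" where
  "generating_mset G S \<longleftrightarrow>
     set_mset S \<subseteq> carrier G \<and> generate G (set_mset S) = carrier G"

text \<open>The pair \<open>(s, i)\<close> with \<open>i < count S s\<close> stands for the \<open>i\<close>-th copy of \<open>s\<close> in \<open>S\<close>,
  so that words are counted with multiplicity.\<close>

definition copies :: "'a multiset \<Rightarrow> ('a \<times> nat) set" where
  "copies S = {(s, i). i < count S s}"

definition closed_words ::
  "('a, 'b) monoid_scheme \<Rightarrow> 'a multiset \<Rightarrow> nat \<Rightarrow> ('a \<times> nat) list set" where
  "closed_words G S l =
     {w. length w = l \<and> set w \<subseteq> copies S \<and>
         foldr (\<otimes>\<^bsub>G\<^esub>) (map fst w) \<one>\<^bsub>G\<^esub> = \<one>\<^bsub>G\<^esub>}"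

lemma finite_copies: "finite (copies S)"
proof -
  have "copies S = (SIGMA s:set_mset S. {..<count S s})"
    by (auto simp: copies_def simp flip: count_greater_zero_iff)
  then show ?thesis by simp
qed

lemma finite_closed_words: "finite (closed_words G S l)"
  by (rule finite_subset[OF _ finite_lists_length_eq[OF finite_copies[of S], of l]])
    (auto simp: closed_words_def)

definition green_series :: "('a, 'b) monoid_scheme \<Rightarrow> 'a multiset \<Rightarrow> int fps" where
  "green_series G S = Abs_fps (\<lambda>l. int (card (closed_words G S l)))"

definition D_finite :: "int fps \<Rightarrow> bool" where
  "D_finite f \<longleftrightarrow>
     (\<exists>(k::nat) (p :: nat \<Rightarrow> int poly). p 0 \<noteq> 0 \<and>
        (\<forall>n\<ge>k. (\<Sum>i\<le>k. poly (p i) (int n) * fps_nth f (n - i)) = 0))"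

end

theory Submission
  imports Defs "HOL-Number_Theory.Cong" "HOL-Computational_Algebra.Squarefree"
begin

text \<open>
  The multiset consists of one copy of \<open>g = 1 + 3 E\<^sub>1\<^sub>2\<close>, 27 copies of five matrices
  \<open>s\<^sub>1, \<dots>, s\<^sub>5\<close>, and \<open>3 ^ 20\<close> copies of a generating set. The \<open>s\<^sub>k\<close> conjugate the powers of \<open>g\<close>
  so that \<open>s\<^sub>1 g\<^sup>a s\<^sub>2 g\<^sup>b s\<^sub>3 g\<^sup>c s\<^sub>4 g\<^sup>d s\<^sub>5 g\<^sup>e\<close> is the product of the elementary matrices
  with entries \<open>3a, -3b, -3c, -3d, 3e\<close> at the positions \<open>(2,3), (1,2), (2,3), (1,3), (1,2)\<close>;
  by the commutator relation in the Heisenberg group it is trivial iff \<open>a = c\<close>, \<open>b = e\<close> and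
  \<open>d = 3ab\<close>. Modulo 3, where \<open>g\<close> is trivial, the only relations of length at most 5 between the
  \<open>s\<^sub>k\<close> are the rotations of \<open>s\<^sub>1 s\<^sub>2 s\<^sub>3 s\<^sub>4 s\<^sub>5\<close>. As words with more of these letters carry a
  larger power of 3, the number of closed words of length \<open>n\<close>, divided by \<open>n\<close> to account for
  rotations, is 3-adically dominated by the number of \<open>(a, b)\<close> with \<open>5 + 2a + 2b + 3ab = n\<close>, that is
  \<open>(3a + 2)(3b + 2) = 3n - 11\<close>. So it counts divisors of \<open>3n - 11\<close>, and by the Chinese remainder
  theorem this count is nonzero modulo 3 at isolated places in every residue class modulo a power
  of 3. A recurrence with polynomial coefficients, divided by its 3-adic content, forbids that.
\<close>

section \<open>An obstruction to D-finiteness\<close>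

lemma cong_poly_int:
  fixes p :: "int poly"
  assumes "[x = y] (mod m)"
  shows "[poly p x = poly p y] (mod m)"
proof (induction p)
  case (pCons a p)
  then show ?case using assms by (simp add: cong_add cong_mult)
qed simp

lemma exists_nonroot_int:
  fixes p :: "int poly"
  assumes "p \<noteq> 0"
  shows "\<exists>n\<ge>L. poly p (int n) \<noteq> 0"
proof (rule ccontr)
  assume "\<not> ?thesis"
  then have "int ` {L..} \<subseteq> {x. poly p x = 0}" by auto
  then have "finite (int ` {L..})" using poly_roots_finite[OF assms] finite_subset by blast
  then show False using finite_imageD[of int "{L..}"] infinite_Ici by auto
qed

text \<open>The congruences hold modulo a power of \<open>q\<close> that grows with \<open>n\<close>, because dividing a
  recurrence by its content at \<open>n\<close> costs as many powers of \<open>q\<close> as divide that content.\<close>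

lemma not_D_finite_by_congruences:
  fixes f :: "int fps" and K :: "nat \<Rightarrow> nat" and q m :: nat
  assumes q: "prime q"
    and f: "\<And>n e. n > 0 \<Longrightarrow> q ^ e dvd n \<Longrightarrow>
      int q ^ (m + 1 + e) dvd fps_nth f n - int q ^ m * int n * int (K n)"
    and K: "\<And>n0 V k j. j \<le> k \<Longrightarrow> \<exists>n>k. [n = n0] (mod q ^ V) \<and> \<not> q dvd K (n - j) \<and>
      (\<forall>i\<le>k. i \<noteq> j \<longrightarrow> q dvd K (n - i))"
  shows "\<not> D_finite f"
proof
  assume "D_finite f"
  then obtain k p where p0: "p 0 \<noteq> 0" and rec:
    "\<And>n. n \<ge> k \<Longrightarrow> (\<Sum>i\<le>k. poly (p i) (int n) * fps_nth f (n - i)) = 0"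
    unfolding D_finite_def by blast
  \<comment> \<open>The factor \<open>n - i\<close> from the congruence for
    \<open>fps_nth f (n - i)\<close> is absorbed into the coefficient, so that the recurrence turns
    into a linear congruence between the numbers \<open>K (n - i)\<close>.\<close>
  define r where "r i x = poly (p i) x * (x - int i)" for i x
  obtain n0 where n0: "n0 \<ge> Suc k" "poly (p 0) (int n0) \<noteq> 0"
    using exists_nonroot_int[OF p0] by blast
  have r0: "r 0 (int n0) \<noteq> 0" using n0 by (simp add: r_def)
  define I where "I = {i. i \<le> k \<and> r i (int n0) \<noteq> 0}"
  define w where "w i = multiplicity (int q) (r i (int n0))" for i
  have "0 \<in> I" using r0 by (simp add: I_def)
  have "finite I" by (simp add: I_def)
  \<comment> \<open>\<open>j\<close> has the least \<open>q\<close>-adic valuation \<open>v\<close>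
    among the coefficients that do not vanish at \<open>n0\<close>: \<open>q ^ v\<close> divides all
    of them, and \<open>q ^ (v + 1)\<close> does not divide the one at \<open>j\<close>.\<close>
  obtain j where j: "j \<in> I" "\<And>i. i \<in> I \<Longrightarrow> w j \<le> w i"
    using ex_min_if_finite[of "w ` I"] \<open>0 \<in> I\<close> \<open>finite I\<close>
    by (metis (no_types, lifting) finite_imageI image_iff empty_iff linorder_not_le)
  define v where "v = w j"
  have jk: "j \<le> k" "r j (int n0) \<noteq> 0" using j(1) by (auto simp: I_def)
  have qu: "\<not> is_unit (int q)" using q prime_gt_1_nat[OF q] by simp
  have dv: "int q ^ v dvd r i (int n0)" if "i \<le> k" for i
  proof (cases "i \<in> I")
    case True
    then have "v \<le> w i" using j(2) by (simp add: v_def)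
    then show ?thesis unfolding w_def by (rule multiplicity_dvd')
  qed (use that in \<open>simp add: I_def\<close>)
  have ndv: "\<not> int q ^ (v + 1) dvd r j (int n0)"
    unfolding v_def w_def
    using jk(2) qu by (subst power_dvd_iff_le_multiplicity) auto
  \<comment> \<open>Agreement with \<open>n0\<close> modulo \<open>q ^ (v + 1)\<close> transfers
    both facts to \<open>n\<close>, while \<open>j\<close> is the only index up to \<open>k\<close>
    at which \<open>K (n - i)\<close> is prime to \<open>q\<close>.\<close>
  obtain n where n: "n > k" "[n = n0] (mod q ^ (v + 1))" "\<not> q dvd K (n - j)"
    "\<And>i. i \<le> k \<Longrightarrow> i \<noteq> j \<Longrightarrow> q dvd K (n - i)"
    using K[OF jk(1)] by metis
  have rc: "[r i (int n) = r i (int n0)] (mod int q ^ (v + 1))" for i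
  proof -
    have "[int n = int n0] (mod int q ^ (v + 1))" using n(2) by (simp flip: cong_int_iff)
    then show ?thesis unfolding r_def by (intro cong_mult cong_diff cong_poly_int cong_refl)
  qed
  have dvn: "int q ^ v dvd r i (int n)" if "i \<le> k" for i
  proof -
    have "[r i (int n) = r i (int n0)] (mod int q ^ v)"
      using rc by (rule cong_dvd_modulus) simp
    then show ?thesis using dv[OF that] by (simp add: cong_dvd_iff)
  qed
  have summand: "[poly (p i) (int n) * fps_nth f (n - i) =
      int q ^ m * r i (int n) * int (K (n - i))] (mod int q ^ (m + 1 + v))" if i: "i \<le> k" for i
  proof -
    \<comment> \<open>The exact power of \<open>q\<close> in \<open>n - i\<close> is
      \<open>q ^ e\<close>, so \<open>q ^ v\<close> divides the polynomial value times
      \<open>q ^ e\<close>. Multiplied by that value, an error divisible by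
      \<open>q ^ (m + 1 + e)\<close> becomes divisible by \<open>q ^ (m + 1 + v)\<close>.\<close>
    define e where "e = multiplicity q (n - i)"
    have pos: "n - i > 0" using i n(1) by simp
    have "q ^ e dvd n - i" unfolding e_def by (rule multiplicity_dvd)
    then obtain y where y: "n - i = q ^ e * y" by blast
    have "\<not> q dvd y"
    proof
      assume "q dvd y"
      then have "q ^ Suc e dvd n - i" by (simp add: y mult.commute mult_dvd_mono)
      then have "Suc e \<le> e" unfolding e_def using pos q
        by (metis multiplicity_geI not_prime_unit neq0_conv)
      then show False by simp
    qed
    then have "coprime (int q ^ v) (int y)" using q
      by (metis coprime_int_iff coprime_power_left_iff prime_imp_coprime)
    moreover have "int n - int i = int q ^ e * int y"
      using y pos by (metis of_nat_diff of_nat_mult of_nat_power less_imp_le zero_less_diff)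
    then have "r i (int n) = (poly (p i) (int n) * int q ^ e) * int y" by (simp add: r_def)
    ultimately have 1: "int q ^ v dvd poly (p i) (int n) * int q ^ e"
      using dvn[OF i] by (simp add: coprime_dvd_mult_left_iff)
    have "int q ^ (m + 1 + e) dvd fps_nth f (n - i) - int q ^ m * int (n - i) * int (K (n - i))"
      using f[OF pos] y by simp
    then have "poly (p i) (int n) * int q ^ (m + 1 + e) dvd poly (p i) (int n) *
        (fps_nth f (n - i) - int q ^ m * int (n - i) * int (K (n - i)))" by (rule mult_dvd_mono[OF dvd_refl])
    moreover have "int q ^ (m + 1 + v) dvd poly (p i) (int n) * int q ^ (m + 1 + e)"
      using mult_dvd_mono[OF 1 dvd_refl[of "int q ^ (m + 1)"]] by (simp add: power_add mult_ac)
    ultimately have "int q ^ (m + 1 + v) dvd poly (p i) (int n) *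
        (fps_nth f (n - i) - int q ^ m * int (n - i) * int (K (n - i)))" by (rule dvd_trans[rotated])
    moreover have "int (n - i) = int n - int i" using pos by simp
    ultimately show ?thesis by (simp add: cong_iff_dvd_diff r_def algebra_simps)
  qed
  have "[(\<Sum>i\<le>k. poly (p i) (int n) * fps_nth f (n - i)) =
      (\<Sum>i\<le>k. int q ^ m * r i (int n) * int (K (n - i)))] (mod int q ^ (m + 1 + v))"
    by (rule cong_sum) (use summand in simp)
  then have "int q ^ (m + 1 + v) dvd (\<Sum>i\<le>k. int q ^ m * r i (int n) * int (K (n - i)))"
    using rec[of n] n(1) by (simp add: cong_0_iff cong_sym_eq[of 0])
  also have "(\<Sum>i\<le>k. int q ^ m * r i (int n) * int (K (n - i))) =
      int q ^ m * (\<Sum>i\<le>k. r i (int n) * int (K (n - i)))" by (simp add: sum_distrib_left mult.assoc)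
  finally have "int q ^ m * int q ^ (v + 1) dvd int q ^ m * (\<Sum>i\<le>k. r i (int n) * int (K (n - i)))"
    by (simp add: power_add mult_ac)
  then have S: "int q ^ (v + 1) dvd (\<Sum>i\<le>k. r i (int n) * int (K (n - i)))"
    using prime_gt_0_nat[OF q] by simp
  have "(\<Sum>i\<le>k. r i (int n) * int (K (n - i))) = r j (int n) * int (K (n - j)) +
      (\<Sum>i\<in>{..k} - {j}. r i (int n) * int (K (n - i)))"
    using jk(1) by (simp add: sum.remove)
  moreover have "int q ^ (v + 1) dvd (\<Sum>i\<in>{..k} - {j}. r i (int n) * int (K (n - i)))"
  proof (rule dvd_sum)
    fix i assume "i \<in> {..k} - {j}"
    then have "int q ^ v * int q dvd r i (int n) * int (K (n - i))"
      using dvn n(4) by (intro mult_dvd_mono) auto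
    then show "int q ^ (v + 1) dvd r i (int n) * int (K (n - i))" by (simp add: mult.commute)
  qed
  ultimately have "int q ^ (v + 1) dvd r j (int n) * int (K (n - j))"
    using S by (simp add: dvd_add_left_iff)
  moreover have "coprime (int q ^ (v + 1)) (int (K (n - j)))" using n(3) q
    by (metis coprime_int_iff coprime_power_left_iff of_nat_power prime_imp_coprime)
  ultimately have "int q ^ (v + 1) dvd r j (int n)" by (simp add: coprime_dvd_mult_left_iff)
  then show False using ndv rc[of j] by (simp add: cong_dvd_iff)
qed

section \<open>Divisor counts modulo 3\<close>

text \<open>A prime \<open>q\<close> divides \<open>t\<close> at most once, so the divisors of
  \<open>t = q * u\<close> are those of \<open>u\<close> and their \<open>q\<close>-multiples, and
  the count doubles. It matters later that powers of 2 are prime to 3.\<close>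

lemma card_divisors_squarefree:
  fixes t :: nat
  assumes "squarefree t"
  shows "\<exists>k. card {d. d dvd t} = 2 ^ k"
  using assms
proof (induction t rule: less_induct)
  case (less t)
  have t0: "t \<noteq> 0" using squarefreeD[OF less.prems, of 2] by (cases "t = 0") auto
  show ?case
  proof (cases "t = 1")
    case True
    then have "{d. d dvd t} = {1}" by auto
    then have "card {d. d dvd t} = 2 ^ 0" by simp
    then show ?thesis by blast
  next
    case False
    then obtain q where q: "prime q" "q dvd t" using prime_factor_nat by blast
    then obtain u where u: "t = q * u" by blast
    have nd: "\<not> q dvd u"
    proof
      assume "q dvd u"
      then have "q ^ 2 dvd t" by (auto simp: u power2_eq_square)
      then show False using squarefreeD[OF less.prems] q(1) by (metis not_prime_unit)
    qed
    have "u < t" using u t0 prime_gt_1_nat[OF q(1)] by auto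
    moreover have "squarefree u" using less.prems u by (meson dvd_triv_right squarefree_mono)
    ultimately obtain k where k: "card {d. d dvd u} = 2 ^ k" using less.IH by blast
    have eq: "{d. d dvd t} = {d. d dvd u} \<union> (*) q ` {d. d dvd u}" (is "?A = ?B")
    proof
      show "?A \<subseteq> ?B"
      proof
        fix d assume "d \<in> ?A"
        then have d: "d dvd q * u" by (simp add: u)
        show "d \<in> ?B"
        proof (cases "q dvd d")
          case True
          then obtain e where "d = q * e" by blast
          then show ?thesis using d q(1) by auto
        next
          case False
          then have "coprime d q" using q(1) by (metis coprime_commute prime_imp_coprime)
          then show ?thesis using d by (auto simp: coprime_dvd_mult_right_iff)
        qed
      qed
      show "?B \<subseteq> ?A" by (auto simp: u)
    qed
    have "card {d. d dvd t} = card {d. d dvd u} + card ((*) q ` {d. d dvd u})"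
      unfolding eq
    proof (rule card_Un_disjoint)
      have "finite {d. d dvd u}" using t0 u by (intro finite_divisors_nat) auto
      then show "finite {d. d dvd u}" "finite ((*) q ` {d. d dvd u})" by auto
      show "{d. d dvd u} \<inter> (*) q ` {d. d dvd u} = {}"
        using nd by (auto dest: dvd_mult_left)
    qed
    also have "card ((*) q ` {d. d dvd u}) = card {d. d dvd u}"
      using q(1) by (intro card_image inj_onI) (auto simp: prime_gt_0_nat)
    finally have "card {d. d dvd t} = 2 ^ Suc k" by (simp add: k)
    then show ?thesis by blast
  qed
qed

section \<open>Squarefree numbers in arithmetic progressions\<close>

text \<open>Each term is at most \<open>1 / (m - 1) - 1 / m\<close>, and the sum telescopes. It
  starts at 5, the least integer above 1 that is prime to 6.\<close>

lemma sum_inverse_squares_le: "(\<Sum>m=5..R. 1 / real m ^ 2) \<le> 1 / 4"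
proof (cases "R \<ge> 5")
  case True
  have "(\<Sum>m=5..R. 1 / real m ^ 2) \<le> 1 / 4 - 1 / real R" using True
  proof (induction R rule: dec_induct)
    case base
    then show ?case by simp
  next
    case (step n)
    have "1 / real (Suc n) ^ 2 \<le> 1 / real n - 1 / real (Suc n)"
      using step(1) by (simp add: divide_simps power2_eq_square)
    then show ?case using step by simp
  qed
  moreover have "1 / real R \<ge> 0" by simp
  ultimately show ?thesis by linarith
qed simp

text \<open>As \<open>Q\<close> is invertible modulo \<open>m ^ 2\<close>, the counted
  \<open>s\<close> lie in a single residue class, where the quotient \<open>s div m ^ 2\<close>
  separates them.\<close>

lemma card_progression_divisible:
  fixes a Q X m :: nat
  assumes "coprime m Q" "m > 0"
  shows "card {s. s < X \<and> m ^ 2 dvd a + Q * s} \<le> X div m ^ 2 + 1"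
proof -
  let ?A = "{s. s < X \<and> m ^ 2 dvd a + Q * s}"
  have "inj_on (\<lambda>s. s div m ^ 2) ?A"
  proof (rule inj_onI)
    fix s s' assume s: "s \<in> ?A" "s' \<in> ?A" and eq: "s div m ^ 2 = s' div m ^ 2"
    have "[a + Q * s = a + Q * s'] (mod m ^ 2)"
      using s by (auto simp: cong_def dvd_eq_mod_eq_0)
    then have "[Q * s = Q * s'] (mod m ^ 2)" by (simp add: cong_add_lcancel_nat)
    moreover have "coprime Q (m ^ 2)" using assms by (simp add: coprime_commute)
    ultimately have "[s = s'] (mod m ^ 2)" by (simp add: cong_mult_lcancel_nat)
    then show "s = s'" using eq by (metis cong_def mod_div_decomp)
  qed
  then have "card ?A = card ((\<lambda>s. s div m ^ 2) ` ?A)" by (simp add: card_image)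
  also have "\<dots> \<le> card {..X div m ^ 2}"
    by (intro card_mono) (auto simp: div_le_mono)
  finally show ?thesis by simp
qed

text \<open>A sieve by squares: of the \<open>X\<close> terms \<open>a + Q * s\<close>, at most
  \<open>X / 4 + R < X\<close> are divisible by the square of some \<open>m\<close> in
  \<open>P\<close>. A prime divisor of a term is prime to \<open>Q\<close>, hence at least 5, and a
  prime above \<open>R\<close> has a square exceeding every term.\<close>

lemma squarefree_in_progression:
  fixes \<tau> Q L :: nat
  assumes "coprime \<tau> Q" "6 dvd Q" "Q > 0"
  shows "\<exists>t\<ge>L. [t = \<tau>] (mod Q) \<and> squarefree t"
proof -
  define a where "a = \<tau> + L * Q"
  \<comment> \<open>Chosen so that \<open>R ^ 2\<close> bounds all terms \<open>a + Q * s\<close>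
    with \<open>s < 2 * R\<close>.\<close>
  define R where "R = 4 * (a + Q)"
  define X where "X = 2 * R"
  define P where "P = {m. 5 \<le> m \<and> m \<le> R \<and> coprime m Q}"
  define bad where "bad m = {s. s < X \<and> m ^ 2 dvd a + Q * s}" for m
  have finP: "finite P" unfolding P_def by (rule finite_subset[of _ "{..R}"]) auto
  have R0: "R > 0" using assms(3) by (simp add: R_def)
  have "real (card (\<Union>m\<in>P. bad m)) \<le> real (\<Sum>m\<in>P. card (bad m))"
    using card_UN_le[OF finP] by (simp del: of_nat_sum)
  also have "\<dots> \<le> (\<Sum>m\<in>P. real X * (1 / real m ^ 2) + 1)"
    unfolding of_nat_sum
  proof (rule sum_mono)
    fix m assume m: "m \<in> P"
    have "card (bad m) \<le> X div m ^ 2 + 1"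
      unfolding bad_def using m by (intro card_progression_divisible) (auto simp: P_def)
    then have "real (card (bad m)) \<le> real (X div m ^ 2) + 1" by linarith
    also have "real (X div m ^ 2) \<le> real X / real (m ^ 2)" by (rule of_nat_div_le_of_nat)
    finally show "real (card (bad m)) \<le> real X * (1 / real m ^ 2) + 1" by simp
  qed
  also have "\<dots> \<le> (\<Sum>m=5..R. real X * (1 / real m ^ 2) + 1)"
    by (intro sum_mono2) (auto simp: P_def)
  also have "\<dots> = real X * (\<Sum>m=5..R. 1 / real m ^ 2) + real (R - 4)"
    by (simp add: sum.distrib sum_distrib_left)
  also have "\<dots> \<le> real X * (1 / 4) + real R"
    by (intro add_mono mult_left_mono sum_inverse_squares_le) auto
  also have "\<dots> < real X" using R0 by (simp add: X_def)
  finally have lt: "card (\<Union>m\<in>P. bad m) < X" by simp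
  have "\<exists>s<X. s \<notin> (\<Union>m\<in>P. bad m)"
  proof (rule ccontr)
    assume "\<not> ?thesis"
    then have "{..<X} \<subseteq> (\<Union>m\<in>P. bad m)" by auto
    then have "X \<le> card (\<Union>m\<in>P. bad m)"
      using card_mono[of "\<Union>m\<in>P. bad m" "{..<X}"] finP by (auto simp: bad_def)
    then show False using lt by simp
  qed
  then obtain s where s: "s < X" "s \<notin> (\<Union>m\<in>P. bad m)" by blast
  define t where "t = a + Q * s"
  have cong: "[t = \<tau>] (mod Q)"
    by (simp add: t_def a_def cong_def mult.commute)
  have cop: "coprime t Q" using assms(1) cong cong_imp_coprime cong_sym by blast
  have "t \<noteq> 0"
  proof
    assume "t = 0"
    then have "Q = 1" using cop by simp
    then show False using assms(2) by simp
  qed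
  have "squarefree t"
  proof (rule ccontr)
    assume "\<not> squarefree t"
    then obtain p where p: "prime p" "p ^ 2 dvd t"
      using squarefree_factorial_semiring[OF \<open>t \<noteq> 0\<close>] by auto
    have "p dvd t" using p(2) by (metis dvd_trans dvd_triv_left power2_eq_square)
    then have pQ: "coprime p Q" using cop by (meson coprime_divisors dvd_refl)
    then have "coprime p 6" using assms(2) by (meson coprime_divisors dvd_refl)
    then have "p \<noteq> 2" "p \<noteq> 3"
      using coprime_common_divisor_nat[of 2 6 2] coprime_common_divisor_nat[of 3 6 3] by auto
    moreover have "p \<noteq> 4" using p(1) by auto
    moreover have "p \<ge> 2" using p(1) prime_ge_2_nat by blast
    ultimately have "p \<ge> 5" by linarith
    moreover have "p \<le> R"
    proof (rule ccontr)
      assume "\<not> p \<le> R"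
      then have "R ^ 2 < p ^ 2" by (intro power_strict_mono) auto
      also have "p ^ 2 \<le> t" using p(2) \<open>t \<noteq> 0\<close> by (simp add: dvd_imp_le)
      also have "t \<le> a + Q * X" using s(1) by (simp add: t_def)
      also have "\<dots> \<le> R ^ 2"
      proof -
        have "a \<le> a * Q" using assms(3) by simp
        moreover have "R ^ 2 = a + Q * X + 16 * (a * a) + 8 * (Q * Q) + 24 * (a * Q) - a"
          by (simp add: X_def R_def power2_eq_square algebra_simps)
        ultimately show ?thesis by linarith
      qed
      finally show False by simp
    qed
    ultimately have "p \<in> P" using pQ by (simp add: P_def)
    moreover have "s \<in> bad p" using s(1) p(2) by (simp add: bad_def t_def)
    ultimately show False using s(2) by blast
  qed
  moreover have "t \<ge> L" using assms(3) by (cases Q) (auto simp: t_def a_def)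
  ultimately show ?thesis using cong by blast
qed

section \<open>The length equation and divisors congruent to 2 modulo 3\<close>

definition box_count :: "nat \<Rightarrow> nat" where
  "box_count n = card {(i, j). 2 * i + 2 * j + 3 * i * j + 5 = n}"

text \<open>Three times the equation factors as
  \<open>(3 * i + 2) * (3 * j + 2) = 3 * n - 11\<close>. The right side is 1 modulo 3, so a divisor
  that is 2 modulo 3 has a cofactor of the same kind.\<close>

lemma box_count_eq_divisors:
  assumes "n \<ge> 5"
  shows "box_count n = card {d. d dvd 3 * n - 11 \<and> d mod 3 = 2}"
proof -
  have N: "(3 * i + 2) * (3 * j + 2) = 3 * n - 11 \<longleftrightarrow> 2 * i + 2 * j + 3 * i * j + 5 = n" for i j :: nat
  proof -
    have "(3 * i + 2) * (3 * j + 2) + 11 = 3 * (2 * i + 2 * j + 3 * i * j + 5)"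
      by (simp add: algebra_simps)
    moreover have "x = 3 * n - 11 \<longleftrightarrow> y = n" if "x + 11 = 3 * y" for x y
      using assms that by presburger
    ultimately show ?thesis by blast
  qed
  have "bij_betw (\<lambda>(i, j). 3 * i + 2) {(i, j). 2 * i + 2 * j + 3 * i * j + 5 = n}
     {d. d dvd 3 * n - 11 \<and> d mod 3 = 2}"
    unfolding bij_betw_def
  proof
    show "inj_on (\<lambda>(i, j). 3 * i + 2) {(i, j). 2 * i + 2 * j + 3 * i * j + 5 = n}"
    proof (rule inj_onI)
      fix x y assume xy: "x \<in> {(i, j). 2 * i + 2 * j + 3 * i * j + 5 = n}"
        "y \<in> {(i, j). 2 * i + 2 * j + 3 * i * j + 5 = n}"
        and eq: "(case x of (i, j) \<Rightarrow> 3 * i + 2) = (case y of (i, j) \<Rightarrow> 3 * i + (2::nat))"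
      obtain i j i' j' where x: "x = (i, j)" and y: "y = (i', j')" by fastforce
      have i: "i' = i" using eq by (simp add: x y)
      have "(3 * i + 2) * (3 * j + 2) = (3 * i + 2) * (3 * j' + 2)"
        using xy N[of i j] N[of i j'] by (simp add: x y i)
      then have "j = j'" by (simp only: mult_cancel1) simp
      then show "x = y" by (simp add: x y i)
    qed
    show "(\<lambda>(i, j). 3 * i + 2) ` {(i, j). 2 * i + 2 * j + 3 * i * j + 5 = n}
       = {d. d dvd 3 * n - 11 \<and> d mod 3 = 2}"
    proof (intro equalityI subsetI)
      fix d assume "d \<in> (\<lambda>(i, j). 3 * i + 2) ` {(i, j). 2 * i + 2 * j + 3 * i * j + 5 = n}"
      then obtain i j where ij: "2 * i + 2 * j + 3 * i * j + 5 = n" and d: "d = 3 * i + 2" by auto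
      have "3 * n - 11 = d * (3 * j + 2)" using N[of i j] ij d by simp
      then have "d dvd 3 * n - 11" by simp
      moreover have "d mod 3 = 2" unfolding d by presburger
      ultimately show "d \<in> {d. d dvd 3 * n - 11 \<and> d mod 3 = 2}" by simp
    next
      fix d assume "d \<in> {d. d dvd 3 * n - 11 \<and> d mod 3 = 2}"
      then have "d dvd 3 * n - 11" and d: "d mod 3 = 2" by simp_all
      then obtain e where e: "3 * n - 11 = d * e" by (elim dvdE)
      obtain m where "n = m + 4" using assms le_Suc_ex[of 4 n] by (auto simp: add.commute)
      then have "3 * n - 11 = 1 + m * 3" by simp
      then have "d * e = 1 + m * 3" unfolding e .
      then have "(d * e) mod 3 = 1" by (simp only: mod_mult_self1) simp
      then have "(2 * e) mod 3 = 1" using d by (metis mod_mult_left_eq)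
      then have "e mod 3 = 2" by presburger
      then have "d = 3 * (d div 3) + 2" "e = 3 * (e div 3) + 2" using d by presburger+
      then obtain i j where "d = 3 * i + 2" "e = 3 * j + 2" by blast
      then show "d \<in> (\<lambda>(i, j). 3 * i + 2) ` {(i, j). 2 * i + 2 * j + 3 * i * j + 5 = n}"
        using N[of i j] e by (auto intro!: image_eqI[of _ _ "(i, j)"])
    qed
  qed
  then show ?thesis unfolding box_count_def by (rule bij_betw_same_card)
qed

text \<open>Multiplication by \<open>l\<^sup>2\<close> preserves residues modulo 3 and cuts the set of divisors into chains of length 3.\<close>

lemma three_dvd_card_divisors:
  fixes l u :: nat
  assumes l: "prime l" "l \<noteq> 3" and u: "\<not> l dvd u"
  shows "3 dvd card {d. d dvd l ^ 5 * u \<and> d mod 3 = 2}"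
proof -
  have u0: "u \<noteq> 0" using u by (metis dvd_0_right)
  have l2: "l ^ 2 mod 3 = 1"
  proof -
    have "\<not> 3 dvd l" using l primes_dvd_imp_eq[of 3 l] by auto
    then have "l mod 3 = 1 \<or> l mod 3 = 2" by presburger
    then show ?thesis by (auto simp: power2_eq_square mod_mult_eq[of l 3 l, symmetric])
  qed
  have l2s: "(l ^ (2 * s) * d) mod 3 = d mod 3" for s d
  proof -
    have "[l ^ (2 * s) * d = 1 ^ s * d] (mod 3)"
      unfolding power_mult using l2 by (intro cong_mult cong_pow cong_refl) (simp add: cong_def)
    then show ?thesis by (simp add: cong_def)
  qed
  have nz: "l \<noteq> 0" using l by auto
  let ?D = "{d. d dvd l * u \<and> d mod 3 = 2}"
  let ?E = "{d. d dvd l ^ 5 * u \<and> d mod 3 = 2}"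
  have mult: "multiplicity l d \<le> 1" if "d dvd l * u" for d
  proof -
    have "multiplicity l d \<le> multiplicity l (l * u)"
      using that nz u0 by (intro dvd_imp_multiplicity_le) auto
    also have "\<dots> = 1" using l u u0 nz
      by (simp add: prime_elem_multiplicity_mult_distrib not_dvd_imp_multiplicity_0 prime_gt_1_nat)
    finally show ?thesis .
  qed
  \<comment> \<open>An exponent of \<open>l\<close> up to 5 is uniquely \<open>2 * s\<close> plus 0
    or 1 with \<open>s < 3\<close>; the 0 or 1 is left to the divisor of
    \<open>l * u\<close>.\<close>
  have "bij_betw (\<lambda>(s, d). l ^ (2 * s) * d) ({..<3} \<times> ?D) ?E"
    unfolding bij_betw_def
  proof
    show "inj_on (\<lambda>(s, d). l ^ (2 * s) * d) ({..<3} \<times> ?D)"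
    proof (rule inj_onI, clarify)
      fix s d s' d' assume d: "d dvd l * u" "d' dvd l * u" and eq: "l ^ (2 * s) * d = l ^ (2 * s') * d'"
      have d0: "d \<noteq> 0" "d' \<noteq> 0" using d nz u0 by (auto intro!: Nat.gr0I)
      have v: "multiplicity l (l ^ (2 * s) * d) = 2 * s + multiplicity l d" if "d \<noteq> 0" for s d
        using that l nz
        by (simp add: prime_elem_multiplicity_mult_distrib multiplicity_same_power prime_gt_1_nat)
      have "2 * s + multiplicity l d = 2 * s' + multiplicity l d'"
        using v[OF d0(1), of s] v[OF d0(2), of s'] eq by simp
      with mult[OF d(1)] mult[OF d(2)] have "s = s'" by linarith
      then show "s = s' \<and> d = d'" using eq nz by simp
    qed
    show "(\<lambda>(s, d). l ^ (2 * s) * d) ` ({..<3} \<times> ?D) = ?E"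
    proof (intro equalityI subsetI)
      fix e assume "e \<in> (\<lambda>(s, d). l ^ (2 * s) * d) ` ({..<3} \<times> ?D)"
      then obtain s d where s: "s < 3" and d: "d dvd l * u" "d mod 3 = 2" and e: "e = l ^ (2 * s) * d" by auto
      have "l ^ (2 * s) dvd l ^ 4" using s by (intro le_imp_power_dvd) auto
      then have "e dvd l ^ 4 * (l * u)" using d(1) unfolding e by (rule mult_dvd_mono)
      also have "l ^ 4 * (l * u) = l ^ 5 * u" by (simp add: eval_nat_numeral)
      finally show "e \<in> ?E" using d l2s e by simp
    next
      fix e assume "e \<in> ?E"
      then have e: "e dvd l ^ 5 * u" "e mod 3 = 2" by auto
      have e0: "e \<noteq> 0" using e(2) by auto
      define v where "v = multiplicity l e"
      obtain e' where e': "e = l ^ v * e'" "\<not> l dvd e'"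
        using multiplicity_decompose'[of e l] e0 prime_gt_1_nat[OF l(1)] unfolding v_def
        by (metis nat_dvd_1_iff_1 less_irrefl)
      have "v \<le> multiplicity l (l ^ 5 * u)" unfolding v_def
        using e nz u0 by (intro dvd_imp_multiplicity_le) auto
      also have "\<dots> = 5" using l u u0 nz
        by (simp add: prime_elem_multiplicity_mult_distrib not_dvd_imp_multiplicity_0
            multiplicity_same_power prime_gt_1_nat)
      finally have v5: "v \<le> 5" .
      have "coprime e' (l ^ 5)" using e'(2) l(1)
        by (metis coprime_commute coprime_power_right_iff prime_imp_coprime)
      moreover have "e' dvd l ^ 5 * u" using e e' by (meson dvd_mult_right)
      ultimately have e'u: "e' dvd u" by (simp add: coprime_dvd_mult_right_iff)
      define d where "d = l ^ (v mod 2) * e'"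
      have ed: "e = l ^ (2 * (v div 2)) * d"
        unfolding d_def e'(1) by (metis mult.assoc mult_div_mod_eq power_add)
      have "l ^ (v mod 2) dvd l ^ 1" by (intro le_imp_power_dvd) auto
      then have "d dvd l * u" unfolding d_def using e'u by (intro mult_dvd_mono) auto
      moreover have "d mod 3 = 2" using l2s ed e(2) by metis
      moreover have "v div 2 < 3" using v5 by simp
      ultimately show "e \<in> (\<lambda>(s, d). l ^ (2 * s) * d) ` ({..<3} \<times> ?D)"
        using ed by (intro image_eqI[of _ _ "(v div 2, d)"]) auto
    qed
  qed
  then have "card ({..<3::nat} \<times> ?D) = card ?E" by (rule bij_betw_same_card)
  then have "card ?E = 3 * card ?D" by (simp add: card_cartesian_product)
  then show ?thesis by simp
qed

text \<open>For \<open>d\<close> prime to 3 exactly one of \<open>d\<close> and \<open>2 * d\<close>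
  is 2 modulo 3, so the count equals the number of divisors of \<open>t\<close>, a power of
  2.\<close>

lemma not_three_dvd_card_divisors:
  fixes t :: nat
  assumes "squarefree t" "odd t" "\<not> 3 dvd t"
  shows "\<not> 3 dvd card {d. d dvd 2 * t \<and> d mod 3 = 2}"
proof -
  let ?f = "\<lambda>d::nat. if d mod 3 = 2 then d else 2 * d"
  have "bij_betw ?f {d. d dvd t} {d. d dvd 2 * t \<and> d mod 3 = 2}"
    unfolding bij_betw_def
  proof
    show "inj_on ?f {d. d dvd t}"
    proof (rule inj_onI, clarify)
      fix x y assume "x dvd t" "y dvd t" and eq: "?f x = ?f y"
      then have "odd x" "odd y" using assms(2) dvd_trans by blast+
      then show "x = y" using eq by (auto split: if_splits)
    qed
    show "?f ` {d. d dvd t} = {d. d dvd 2 * t \<and> d mod 3 = 2}"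
    proof (intro equalityI subsetI)
      fix e assume "e \<in> ?f ` {d. d dvd t}"
      then obtain d where d: "d dvd t" "e = ?f d" by auto
      have "\<not> 3 dvd d" using d(1) assms(3) dvd_trans by blast
      then have "?f d mod 3 = 2" by presburger
      then show "e \<in> {d. d dvd 2 * t \<and> d mod 3 = 2}" using d by auto
    next
      fix e assume "e \<in> {d. d dvd 2 * t \<and> d mod 3 = 2}"
      then have e: "e dvd 2 * t" "e mod 3 = 2" by auto
      show "e \<in> ?f ` {d. d dvd t}"
      proof (cases "even e")
        case True
        then obtain d where d: "e = 2 * d" by blast
        then have "d dvd t" using e(1) by simp
        moreover have "d mod 3 \<noteq> 2" using e(2) d by presburger
        ultimately show ?thesis using d by (intro image_eqI[of _ _ d]) auto
      next
        case False
        then have "coprime e 2" by simp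
        then have "e dvd t" using e(1) by (simp add: coprime_dvd_mult_right_iff)
        then show ?thesis using e(2) by (intro image_eqI[of _ _ e]) auto
      qed
    qed
  qed
  then have "card {d. d dvd 2 * t \<and> d mod 3 = 2} = card {d. d dvd t}"
    by (rule bij_betw_same_card[symmetric])
  moreover obtain k where "card {d. d dvd t} = 2 ^ k"
    using card_divisors_squarefree[OF assms(1)] by blast
  moreover have "\<not> (3::nat) dvd 2 ^ k"
    using prime_dvd_power_nat[of 3 2 k] by auto
  ultimately show ?thesis by simp
qed

section \<open>Isolated nonzero counts from the Chinese remainder theorem\<close>

lemma ex_half_mod:
  fixes m :: nat and c :: int
  assumes "odd m"
  shows "\<exists>u::nat. [2 * int u = c] (mod int m)"
proof -
  obtain h where h: "m = 2 * h + 1" using assms by (rule oddE)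
  define u where "u = nat ((c * (int h + 1)) mod int m)"
  have "int u = (c * (int h + 1)) mod int m" using h by (simp add: u_def)
  then have "[2 * int u = 2 * (c * (int h + 1))] (mod int m)"
    by (intro cong_mult cong_refl) (simp add: cong_def)
  also have "2 * (c * (int h + 1)) = c + c * int m" by (simp add: h algebra_simps)
  also have "[c + c * int m = c] (mod int m)" by (simp add: cong_def)
  finally show ?thesis by blast
qed

text \<open>The aim is \<open>3 * (n - j) - 11 = 2 * t\<close> with \<open>t\<close> squarefree and
  prime to 6. For \<open>i \<noteq> j\<close> the number \<open>3 * (n - i) - 11\<close> is then
  \<open>2 * t + 3 * (j - i)\<close> over the integers, and a congruence for \<open>t\<close> modulo
  \<open>l i ^ 6\<close> makes the prime \<open>l i\<close> divide it exactly five times.\<close>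

lemma box_count_isolated:
  fixes n0 V k j L :: nat
  assumes "j \<le> k"
  shows "\<exists>n\<ge>L. [n = n0] (mod 3 ^ V) \<and> \<not> 3 dvd box_count (n - j) \<and>
    (\<forall>i\<le>k. i \<noteq> j \<longrightarrow> 3 dvd box_count (n - i))"
proof -
  define P where "P = {p::nat. prime p \<and> p > 3 * k + 3}"
  have "infinite P"
  proof
    assume "finite P"
    then have "finite (P \<union> {..3 * k + 3})" by simp
    then have "finite {p::nat. prime p}" by (rule rev_finite_subset) (auto simp: P_def)
    then show False using primes_infinite by blast
  qed
  define l where "l = enumerate P"
  have l: "prime (l i)" "l i > 3 * k + 3" for i
    using enumerate_in_set[OF \<open>infinite P\<close>, of i] by (auto simp: l_def P_def)
  have l_inj: "l i \<noteq> l i'" if "i \<noteq> i'" for i i'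
    using that strict_mono_enumerate[OF \<open>infinite P\<close>] by (auto simp: l_def strict_mono_eq)
  define I where "I = {..k} - {j}"
  \<comment> \<open>\<open>c i\<close> and \<open>c3\<close> are the residues wanted for
    \<open>2 * t\<close>. Modulo \<open>3 ^ (V + 1)\<close>, \<open>c3\<close> encodes that
    \<open>n\<close> agrees with \<open>n0\<close> modulo \<open>3 ^ V\<close>; the extra 3 is the
    factor in \<open>3 * n\<close>.\<close>
  define c where "c i = int (l i) ^ 5 - 3 * (int j - int i)" for i
  define c3 where "c3 = 3 * (int n0 - int j) - 11"
  \<comment> \<open>Index \<open>k + 1\<close> carries the condition at 3, index
    \<open>k + 2\<close> the condition that \<open>t\<close> is odd.\<close>
  define M where "M i = (if i \<le> k then l i ^ 6 else if i = k + 1 then 3 ^ (V + 1) else 2)" for i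
  define A where "A = I \<union> {k + 1, k + 2}"
  have finA: "finite A" by (simp add: A_def I_def)
  have lodd: "odd (l i)" for i using l[of i] prime_odd_nat[of "l i"] by auto
  have "\<exists>u. \<forall>i. (if i \<le> k then [2 * int (u i) = c i] (mod int (M i))
      else if i = k + 1 then [2 * int (u i) = c3] (mod int (M i)) else u i = 1)"
  proof (intro choice allI)
    fix i
    have "odd (M i)" if "i \<le> k + 1" using that lodd[of i] by (auto simp: M_def)
    then have "i \<le> k + 1 \<Longrightarrow> \<exists>x. [2 * int x = c i] (mod int (M i))"
      "i \<le> k + 1 \<Longrightarrow> \<exists>x. [2 * int x = c3] (mod int (M i))"
      using ex_half_mod by auto
    then show "\<exists>x. if i \<le> k then [2 * int x = c i] (mod int (M i))
      else if i = k + 1 then [2 * int x = c3] (mod int (M i)) else x = 1"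
      by (cases "i \<le> k"; cases "i = k + 1") auto
  qed
  then obtain u where "\<forall>i. (if i \<le> k then [2 * int (u i) = c i] (mod int (M i))
      else if i = k + 1 then [2 * int (u i) = c3] (mod int (M i)) else u i = 1)" by blast
  then have u: "\<And>i. i \<le> k \<Longrightarrow> [2 * int (u i) = c i] (mod int (M i))"
    "[2 * int (u (k + 1)) = c3] (mod int (M (k + 1)))" "u (k + 2) = 1"
    by (auto dest: spec[of _ "k + 1"] spec[of _ "k + 2"] split: if_splits)
  have cop_u: "coprime (u i) (M i)" if iA: "i \<in> A" for i
  proof -
    consider "i \<le> k" "i \<noteq> j" | "i = k + 1" | "i = k + 2" using iA by (auto simp: A_def I_def)
    then show ?thesis
    proof cases
      case 1
      \<comment> \<open>Modulo \<open>l i\<close>, \<open>c i\<close> is \<open>3 * (i - j)\<close>,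
        which is nonzero and at most \<open>3 * k\<close> in absolute value, hence not divisible by
        \<open>l i\<close>.\<close>
      have "\<not> l i dvd u i"
      proof
        assume "l i dvd u i"
        then have 2: "int (l i) dvd 2 * int (u i)" by simp
        have "int (l i) dvd int (M i)" using 1 by (simp add: M_def)
        then have "[2 * int (u i) = c i] (mod int (l i))" using u(1) 1 cong_dvd_modulus by blast
        then have "int (l i) dvd c i" using 2 by (simp add: cong_dvd_iff)
        moreover have "int (l i) dvd int (l i) ^ 5" by simp
        ultimately have "int (l i) dvd 3 * (int j - int i)"
          unfolding c_def by (metis dvd_diff_right_iff dvd_diff_commute)
        then have "int (l i) \<le> \<bar>3 * (int j - int i)\<bar>"
          using 1 dvd_imp_le_int[of "3 * (int j - int i)" "int (l i)"] by simp
        also have "\<dots> \<le> 3 * int k" using 1 assms by auto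
        finally show False using l(2)[of i] by linarith
      qed
      then show ?thesis using l(1)[of i] 1
        by (simp add: M_def coprime_commute prime_imp_coprime)
    next
      case 2
      have "\<not> 3 dvd u i"
      proof
        assume "3 dvd u i"
        then have 3: "(3::int) dvd 2 * int (u i)" by presburger
        have "[2 * int (u i) = c3] (mod 3)"
          using u(2) 2 by (auto simp: M_def intro: cong_dvd_modulus)
        then have "3 dvd c3" using 3 by (simp add: cong_dvd_iff)
        then show False unfolding c3_def by presburger
      qed
      moreover have "prime (3::nat)" by simp
      ultimately have "coprime 3 (u i)" by (rule prime_imp_coprime[rotated])
      then show ?thesis using 2 by (simp add: M_def coprime_commute)
    next
      case 3
      then show ?thesis using u(3) by (simp add: M_def)
    qed
  qed
  have cop_M: "coprime (M i) (M i')" if "i \<in> A" "i' \<in> A" "i \<noteq> i'" for i i'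
  proof -
    define q where "q i = (if i \<le> k then l i else if i = k + 1 then 3 else 2)" for i
    have "prime (q i)" for i using l(1) by (auto simp: q_def)
    moreover have "q i \<noteq> q i'" using that l(2)[of i] l(2)[of i'] l_inj
      by (auto simp: q_def A_def I_def)
    ultimately have "coprime (q i) (q i')" using primes_coprime by blast
    moreover have "M i dvd q i ^ (V + 7)" for i
    proof -
      have "M i = q i ^ (if i \<le> k then 6 else if i = k + 1 then V + 1 else 1)"
        by (simp add: M_def q_def)
      then show ?thesis by (simp only: le_imp_power_dvd split: if_split) (simp add: le_imp_power_dvd)
    qed
    ultimately show ?thesis
      by (meson coprime_divisors coprime_power_left_iff coprime_power_right_iff)
  qed
  obtain \<tau> where \<tau>: "\<forall>i\<in>A. [\<tau> = u i] (mod M i)"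
    using chinese_remainder_nat[OF finA, of M u] cop_M by blast
  define Q where "Q = prod M A"
  have Mpos: "M i > 0" for i using l(1)[of i] by (auto simp: M_def prime_gt_0_nat)
  have "coprime \<tau> Q" unfolding Q_def
  proof (rule prod_coprime_right)
    fix i assume "i \<in> A"
    then show "coprime \<tau> (M i)" using \<tau> cop_u cong_imp_coprime cong_sym by metis
  qed
  have MQ: "M i dvd Q" if "i \<in> A" for i unfolding Q_def using finA that by (rule dvd_prodI)
  have "6 dvd Q"
  proof -
    have "2 dvd Q" "3 dvd Q"
      using MQ[of "k + 2"] MQ[of "k + 1"] by (auto simp: A_def M_def dest: dvd_mult_left)
    then show ?thesis by presburger
  qed
  have "Q > 0" unfolding Q_def using Mpos by (simp add: prod_pos)
  \<comment> \<open>The lower bound on \<open>t\<close> later gives \<open>n \<ge> L\<close> and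
    \<open>n - i \<ge> 5\<close>.\<close>
  obtain t where t: "t \<ge> 3 * L + 3 * k + 20" "[t = \<tau>] (mod Q)" "squarefree t"
    using squarefree_in_progression[OF \<open>coprime \<tau> Q\<close> \<open>6 dvd Q\<close> \<open>Q > 0\<close>] by blast
  have tu: "[t = u i] (mod M i)" if "i \<in> A" for i
    using t(2) MQ[OF that] \<tau> that by (meson cong_dvd_modulus_nat cong_trans)
  have "odd t" using tu[of "k + 2"] u(3) by (auto simp: A_def M_def cong_def odd_iff_mod_2_eq_one)
  have "coprime t 3"
  proof -
    have "coprime t (M (k + 1))"
      by (rule cong_imp_coprime[OF cong_sym[OF tu] cop_u]) (simp_all add: A_def)
    then show ?thesis by (simp add: M_def)
  qed
  then have "\<not> 3 dvd t" using coprime_common_divisor_nat[of t 3 3] by auto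
  have t3: "[2 * int t = c3] (mod 3 ^ (V + 1))"
  proof -
    have "[int t = int (u (k + 1))] (mod int (M (k + 1)))"
      using tu[of "k + 1"] by (simp add: A_def cong_int_iff)
    then have "[2 * int t = 2 * int (u (k + 1))] (mod int (M (k + 1)))" by (intro cong_mult cong_refl)
    then show ?thesis using u(2) cong_trans by (fastforce simp: M_def)
  qed
  have "3 dvd 2 * int t + 11"
  proof -
    have "[2 * int t = c3] (mod 3)" using t3 by (rule cong_dvd_modulus) simp
    then have "(3::int) dvd 2 * int t - c3" by (simp add: cong_iff_dvd_diff)
    then show ?thesis unfolding c3_def by presburger
  qed
  then have "3 dvd 2 * t + 11" by presburger
  then obtain r where r: "2 * t + 11 = 3 * r" by (elim dvdE)
  define n where "n = r + j"
  have n5: "n - i \<ge> 5" "n \<ge> i" if "i \<le> k" for i using r t(1) that by (auto simp: n_def)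
  have "n \<ge> L" using r t(1) by (simp add: n_def)
  have cong_n: "[n = n0] (mod 3 ^ V)"
  proof -
    have "(3::int) ^ (V + 1) dvd 2 * int t - c3" using t3 by (simp add: cong_iff_dvd_diff)
    also have "2 * int t - c3 = 3 * (int n - int n0)" using r by (simp add: c3_def n_def)
    finally have "3 * (3::int) ^ V dvd 3 * (int n - int n0)" by (simp only: Suc_eq_plus1[symmetric] power_Suc)
    then have "(3::int) ^ V dvd int n - int n0" by (subst (asm) dvd_mult_cancel_left) simp
    then have "[int n = int n0] (mod int (3 ^ V))" by (simp add: cong_iff_dvd_diff)
    then show ?thesis by (simp only: cong_int_iff)
  qed
  have "box_count (n - j) = card {d. d dvd 2 * t \<and> d mod 3 = 2}"
  proof -
    have "3 * (n - j) - 11 = 2 * t" using r by (simp add: n_def)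
    then show ?thesis using box_count_eq_divisors[OF n5(1)[OF assms]] by simp
  qed
  then have "\<not> 3 dvd box_count (n - j)"
    using not_three_dvd_card_divisors[OF \<open>squarefree t\<close> \<open>odd t\<close> \<open>\<not> 3 dvd t\<close>] by simp
  moreover have "3 dvd box_count (n - i)" if i: "i \<le> k" "i \<noteq> j" for i
  proof -
    define N where "N = 3 * (n - i) - 11"
    have iA: "i \<in> A" using i by (simp add: A_def I_def)
    have N: "int N = 2 * int t + 3 * (int j - int i)"
      using r n5[OF i(1)] by (simp add: N_def n_def of_nat_diff)
    have "[int t = int (u i)] (mod int (M i))"
      using tu[OF iA] by (simp add: cong_int_iff)
    then have "[2 * int t = 2 * int (u i)] (mod int (M i))" by (intro cong_mult cong_refl)
    then have "[2 * int t = c i] (mod int (M i))" using u(1)[OF i(1)] cong_trans by blast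
    then have "[int N = c i + 3 * (int j - int i)] (mod int (M i))"
      unfolding N by (intro cong_add cong_refl)
    then have "[int N = int (l i ^ 5)] (mod int (l i ^ 6))" using i by (simp add: c_def M_def)
    then have "[N = l i ^ 5] (mod l i ^ 6)" by (simp only: cong_int_iff)
    \<comment> \<open>The residue \<open>l i ^ 5\<close> modulo \<open>l i ^ 6\<close> means that
      \<open>l i\<close> divides \<open>N\<close> exactly five times.\<close>
    then have cN: "[N = l i ^ 5 * 1] (mod l i ^ 5 * l i)" by (simp add: eval_nat_numeral mult_ac)
    then have "l i ^ 5 dvd N" by (metis cong_dvd_iff cong_modulus_mult_nat dvd_triv_left)
    then obtain v where v: "N = l i ^ 5 * v" by blast
    have "[v = 1] (mod l i)" using cN l(1)[of i] unfolding v
      by (simp add: cong_def mod_mult_mult1 prime_gt_0_nat)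
    then have "\<not> l i dvd v" using l(1)[of i]
      by (metis cong_dvd_iff not_prime_unit)
    moreover have "l i \<noteq> 3" using l(2)[of i] by simp
    ultimately have "3 dvd card {d. d dvd N \<and> d mod 3 = 2}"
      unfolding v using three_dvd_card_divisors l(1) by blast
    then show ?thesis using box_count_eq_divisors[OF n5(1)[OF i(1)]] by (simp add: N_def)
  qed
  ultimately show ?thesis using \<open>n \<ge> L\<close> cong_n by blast
qed

section \<open>Closed words up to rotation\<close>

definition closed_lists :: "('a, 'b) monoid_scheme \<Rightarrow> 'a set \<Rightarrow> nat \<Rightarrow> 'a list set" where
  "closed_lists G A n = {w. length w = n \<and> set w \<subseteq> A \<and> foldr (\<otimes>\<^bsub>G\<^esub>) w \<one>\<^bsub>G\<^esub> = \<one>\<^bsub>G\<^esub>}"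

lemma finite_closed_lists: "finite A \<Longrightarrow> finite (closed_lists G A n)"
  by (rule finite_subset[OF _ finite_lists_length_eq[of A n]]) (auto simp: closed_lists_def)

lemma card_copies_lists:
  "card {v. map fst v = w \<and> set v \<subseteq> copies S} = prod_list (map (count S) w)"
proof (induction w)
  case Nil
  have "{v :: ('a \<times> nat) list. map fst v = [] \<and> set v \<subseteq> copies S} = {[]}" by auto
  then show ?case by simp
next
  case (Cons a w)
  let ?F = "{v. map fst v = w \<and> set v \<subseteq> copies S}"
  have "{v. map fst v = a # w \<and> set v \<subseteq> copies S} =
      (\<lambda>(i, v). (a, i) # v) ` ({..<count S a} \<times> ?F)"
  proof (intro equalityI subsetI)
    fix v assume "v \<in> {v. map fst v = a # w \<and> set v \<subseteq> copies S}"
    then obtain i v' where "v = (a, i) # v'" "map fst v' = w" "set v' \<subseteq> copies S" "(a, i) \<in> copies S"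
      by (cases v) auto
    then show "v \<in> (\<lambda>(i, v). (a, i) # v) ` ({..<count S a} \<times> ?F)"
      by (intro image_eqI[of _ _ "(i, v')"]) (auto simp: copies_def)
  qed (auto simp: copies_def)
  moreover have "inj_on (\<lambda>(i, v). (a, i) # v) ({..<count S a} \<times> ?F)"
    by (auto simp: inj_on_def)
  ultimately show ?case by (simp add: card_image card_cartesian_product Cons.IH)
qed

text \<open>Forgetting the copy indices maps closed words onto closed lists; a point of the fibre
  over \<open>w\<close> is a choice of a copy for each letter.\<close>

lemma card_closed_words:
  "card (closed_words G S n) =
    (\<Sum>w\<in>closed_lists G (set_mset S) n. prod_list (map (count S) w))"
proof -
  let ?F = "\<lambda>w. {v. map fst v = w \<and> set v \<subseteq> copies S}"
  have "fst ` copies S \<subseteq> set_mset S" by (auto simp: copies_def intro: count_inI)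
  then have "closed_words G S n = (\<Union>w\<in>closed_lists G (set_mset S) n. ?F w)"
    unfolding closed_words_def closed_lists_def by fastforce
  moreover have "finite (?F w)" for w
    by (rule finite_subset[OF _ finite_lists_length_eq[OF finite_copies[of S], of "length w"]]) auto
  ultimately have "card (closed_words G S n) = (\<Sum>w\<in>closed_lists G (set_mset S) n. card (?F w))"
    by (simp only:) (subst card_UN_disjoint, auto simp: finite_closed_lists)
  then show ?thesis by (simp only: card_copies_lists)
qed

lemma (in group) foldr_mult_closed:
  "set w \<subseteq> carrier G \<Longrightarrow> foldr (\<otimes>) w \<one> \<in> carrier G"
  by (induction w) auto

lemma (in group) foldr_mult_append:
  "set u \<subseteq> carrier G \<Longrightarrow> set v \<subseteq> carrier G \<Longrightarrow>
    foldr (\<otimes>) (u @ v) \<one> = foldr (\<otimes>) u \<one> \<otimes> foldr (\<otimes>) v \<one>"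
  by (induction u) (auto simp: foldr_mult_closed m_assoc simp del: foldr_append)

text \<open>In a group, a right inverse is also a left inverse, so the first letter may move to the
  end.\<close>

lemma (in group) rotate1_closed_lists:
  assumes "A \<subseteq> carrier G" "w \<in> closed_lists G A n"
  shows "rotate1 w \<in> closed_lists G A n"
proof (cases w)
  case (Cons x u)
  then have x: "x \<in> carrier G" and u: "set u \<subseteq> carrier G"
    and eq: "x \<otimes> foldr (\<otimes>) u \<one> = \<one>"
    using assms by (auto simp: closed_lists_def)
  have "foldr (\<otimes>) u \<one> \<otimes> x = \<one>" using eq x foldr_mult_closed[OF u] inv_comm by blast
  then have "foldr (\<otimes>) (u @ [x]) \<one> = \<one>" using foldr_mult_append[OF u, of "[x]"] x by simp
  then show ?thesis using assms Cons by (auto simp: closed_lists_def)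
qed (use assms in simp)

lemma length_filter_rotate1: "length (filter Q (rotate1 w)) = length (filter Q w)"
  by (cases w) auto

lemma prod_list_map_rotate1:
  "prod_list (map c (rotate1 w)) = (prod_list (map c w) :: 'a :: comm_monoid_mult)"
  by (cases w) (auto simp: mult.commute)

text \<open>Double counting: on both sides a word is counted together with a position whose letter satisfies \<open>Q\<close>.\<close>

lemma sum_length_filter_rotation:
  fixes f :: "'a list \<Rightarrow> nat"
  assumes fin: "finite W" and len: "\<And>w. w \<in> W \<Longrightarrow> length w = n"
    and rot: "\<And>w. w \<in> W \<Longrightarrow> rotate1 w \<in> W" and f: "\<And>w. w \<in> W \<Longrightarrow> f (rotate1 w) = f w"
  shows "(\<Sum>w\<in>W. length (filter Q w) * f w) = n * (\<Sum>w | w \<in> W \<and> Q (hd w). f w)"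
proof -
  have rotp: "rotate p w \<in> W \<and> f (rotate p w) = f w" if "w \<in> W" for p w
    using that by (induction p) (auto simp: rot f)
  have bij: "bij_betw (rotate p) W W" for p
  proof -
    have "inj (rotate p :: 'a list \<Rightarrow> _)" unfolding rotate_def by (intro inj_fn inj_rotate1)
    then have "inj_on (rotate p) W" by (rule inj_on_subset) simp
    moreover have "rotate p ` W \<subseteq> W" using rotp by blast
    ultimately show ?thesis using endo_inj_surj[OF fin] by (simp add: bij_betw_def)
  qed
  have "length (filter Q w) * f w = (\<Sum>p<n. of_bool (Q (hd (rotate p w))) * f (rotate p w))"
    if w: "w \<in> W" for w
  proof -
    have "length (filter Q w) = (\<Sum>p<n. of_bool (Q (w ! p)))"
      using len[OF w] by (simp add: length_filter_conv_card sum.If_cases of_bool_def Int_def)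
    also have "\<dots> = (\<Sum>p<n. of_bool (Q (hd (rotate p w))))"
    proof (rule sum.cong[OF refl])
      fix p assume "p \<in> {..<n}"
      then have "hd (rotate p w) = w ! p"
        using len[OF w] hd_rotate_conv_nth[of w p] by force
      then show "of_bool (Q (w ! p)) = (of_bool (Q (hd (rotate p w))) :: nat)" by simp
    qed
    finally show ?thesis using rotp[OF w] by (simp add: sum_distrib_right)
  qed
  then have "(\<Sum>w\<in>W. length (filter Q w) * f w) =
      (\<Sum>w\<in>W. \<Sum>p<n. of_bool (Q (hd (rotate p w))) * f (rotate p w))" by simp
  also have "\<dots> = (\<Sum>p<n. \<Sum>w\<in>W. of_bool (Q (hd (rotate p w))) * f (rotate p w))"
    by (rule sum.swap)
  also have "\<dots> = (\<Sum>p<n. \<Sum>w\<in>W. of_bool (Q (hd w)) * f w)"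
    by (intro sum.cong refl sum.reindex_bij_betw[OF bij, of "\<lambda>w. of_bool (Q (hd w)) * f w"])
  also have "(\<Sum>w\<in>W. of_bool (Q (hd w)) * f w) = (\<Sum>w | w \<in> W \<and> Q (hd w). f w)"
    by (subst sum.inter_filter[OF fin]) (auto intro: sum.cong)
  finally show ?thesis by simp
qed

text \<open>With \<open>J\<close> marked letters in every word, double counting equates
  \<open>J\<close> times the sum with \<open>n\<close> times the sum over words with a marked head.
  The latter product is divisible by \<open>q ^ (M + v + e)\<close>, and cancelling \<open>J\<close>
  costs at most \<open>q ^ v\<close>.\<close>

lemma power_dvd_rotation_sum:
  fixes f :: "'a list \<Rightarrow> nat"
  assumes q: "prime q" and fin: "finite W" and len: "\<And>w. w \<in> W \<Longrightarrow> length w = n"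
    and rot: "\<And>w. w \<in> W \<Longrightarrow> rotate1 w \<in> W" and f: "\<And>w. w \<in> W \<Longrightarrow> f (rotate1 w) = f w"
    and J: "\<And>w. w \<in> W \<Longrightarrow> length (filter Q w) = J" "\<not> q ^ Suc v dvd J"
    and dvd: "\<And>w. w \<in> W \<Longrightarrow> q ^ (M + v) dvd f w" "q ^ e dvd n"
  shows "q ^ (M + e) dvd (\<Sum>w\<in>W. f w)"
proof -
  have "J * (\<Sum>w\<in>W. f w) = n * (\<Sum>w | w \<in> W \<and> Q (hd w). f w)"
    using sum_length_filter_rotation[of W n f Q] fin len rot f J(1)
    by (simp add: sum_distrib_left)
  moreover have "q ^ (M + v) dvd (\<Sum>w | w \<in> W \<and> Q (hd w). f w)" using dvd(1) by (intro dvd_sum) auto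
  ultimately have *: "q ^ e * q ^ (M + v) dvd J * (\<Sum>w\<in>W. f w)" using dvd(2) by (simp add: mult_dvd_mono)
  define u where "u = multiplicity q J"
  have J0: "J \<noteq> 0" using J(2) by (metis dvd_0_right)
  obtain y where y: "J = q ^ u * y" "\<not> q dvd y"
    using multiplicity_decompose'[of J q] J0 q not_prime_unit unfolding u_def by metis
  have "u \<le> v"
  proof (rule ccontr)
    assume "\<not> u \<le> v"
    then have "q ^ Suc v dvd q ^ u" by (intro le_imp_power_dvd) auto
    then show False using J(2) y(1) by auto
  qed
  then have "q ^ e * q ^ (M + v) = q ^ u * q ^ (M + e + (v - u))"
    by (simp flip: power_add) (simp add: add_ac)
  then have "q ^ u * q ^ (M + e + (v - u)) dvd q ^ u * (y * (\<Sum>w\<in>W. f w))"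
    using * by (simp add: y(1) mult.assoc)
  then have "q ^ (M + e + (v - u)) dvd y * (\<Sum>w\<in>W. f w)" using q prime_gt_0_nat by auto
  then have "q ^ (M + e) dvd y * (\<Sum>w\<in>W. f w)" by (rule dvd_trans[rotated]) (simp add: le_imp_power_dvd)
  moreover have "coprime (q ^ (M + e)) y" using q y(2) by (simp add: prime_imp_coprime)
  ultimately show ?thesis by (simp add: coprime_dvd_mult_right_iff)
qed

lemma power_dvd_prod_list_filter:
  fixes c :: "'a \<Rightarrow> nat"
  assumes "\<And>x. x \<in> set w \<Longrightarrow> Q x \<Longrightarrow> d dvd c x"
  shows "d ^ length (filter Q w) dvd prod_list (map c w)"
  using assms by (induction w) (auto simp: mult_dvd_mono)

lemma prod_list_map_filter:
  fixes c :: "'a \<Rightarrow> nat"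
  assumes "\<And>x. x \<in> set w \<Longrightarrow> c x = (if Q x then d else 1)"
  shows "prod_list (map c w) = d ^ length (filter Q w)"
  using assms by (induction w) auto

lemma dvd_prod_list_map: "x \<in> set w \<Longrightarrow> d dvd c x \<Longrightarrow> d dvd prod_list (map c (w :: 'a list) :: nat list)"
  by (induction w) (auto simp: dvd_mult dvd_mult2)

text \<open>Hence the exponent of 3 in a positive \<open>J\<close> is at most
  \<open>J div 3\<close>.\<close>

lemma three_power_bound: "(3::nat) ^ (J div 3 + 1) > J"
proof -
  have "3 ^ (m + 1) \<ge> 3 * m + (3::nat)" for m by (induction m) auto
  from this[of "J div 3"] show ?thesis by linarith
qed

text \<open>Counting rotations divides by the number \<open>J\<close> of letters other than \<open>g\<close>, which loses at most
  \<open>J div 3\<close> factors 3. The multiplicities 27 and \<open>3 ^ 20\<close> outweigh this loss.\<close>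

lemma (in group) green_series_cong:
  fixes S :: "'a multiset" and T :: "'a set"
  assumes S: "set_mset S \<subseteq> carrier G" "insert g T \<subseteq> set_mset S" and g: "g \<notin> T" "count S g = 1"
    and count: "\<And>x. x \<in># S \<Longrightarrow> x \<noteq> g \<Longrightarrow> 27 dvd count S x"
      "\<And>x. x \<in># S \<Longrightarrow> x \<noteq> g \<Longrightarrow> x \<notin> T \<Longrightarrow> 3 ^ 20 dvd count S x"
      "\<And>x. x \<in> T \<Longrightarrow> count S x = 27"
    and few: "\<And>w. w \<in> closed_lists G (insert g T) n \<Longrightarrow> length (filter (\<lambda>x. x \<noteq> g) w) \<le> 5 \<Longrightarrow>
      length (filter (\<lambda>x. x \<noteq> g) w) = 5 \<and> length (filter ((=) s) w) = 1"
    and n: "n > 0" "3 ^ e dvd n"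
  shows "int 3 ^ (15 + 1 + e) dvd fps_nth (green_series G S) n - int 3 ^ 15 * int n *
    int (card {w \<in> closed_lists G (insert g T) n. length (filter (\<lambda>x. x \<noteq> g) w) = 5 \<and> hd w = s})"
proof -
  define Q where "Q = (\<lambda>x. x \<noteq> g)"
  define f where "f w = prod_list (map (count S) w)" for w
  define W where "W = closed_lists G (set_mset S) n"
  \<comment> \<open>\<open>U\<close> yields the main term: each of its words has weight
    \<open>27 ^ 5 = 3 ^ 15\<close>. The classes \<open>R J\<close> of the remaining words only
    contribute to the error.\<close>
  define U where "U = {w \<in> closed_lists G (insert g T) n. length (filter Q w) = 5}"
  define R where "R J = {w \<in> W. w \<notin> U \<and> length (filter Q w) = J}" for J
  have finW: "finite W" by (simp add: W_def finite_closed_lists)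
  have "U \<subseteq> W" using S(2) by (auto simp: U_def W_def closed_lists_def)
  then have finU: "finite U" using finW finite_subset by blast
  have rotW: "rotate1 w \<in> W" if "w \<in> W" for w
    using that rotate1_closed_lists S(1) by (auto simp: W_def)
  have rotU: "rotate1 w \<in> U \<longleftrightarrow> w \<in> U" if "w \<in> W" for w
  proof -
    have "rotate1 w \<in> closed_lists G (insert g T) n \<longleftrightarrow> w \<in> closed_lists G (insert g T) n"
      using that rotW[OF that] by (simp add: W_def closed_lists_def)
    then show ?thesis by (simp add: U_def length_filter_rotate1)
  qed
  have lenW: "length w = n" if "w \<in> W" for w using that by (simp add: W_def closed_lists_def)
  have fr: "f (rotate1 w) = f w" for w by (simp add: f_def prod_list_map_rotate1)
  have few0: False if "w \<in> closed_lists G (insert g T) n" "length (filter Q w) < 5" for w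
    using few[OF that(1)] that(2) by (simp add: Q_def)
  have fU: "f w = 3 ^ 15" if "w \<in> U" for w
  proof -
    have "f w = 27 ^ length (filter Q w)"
      unfolding f_def by (rule prod_list_map_filter)
        (use that count(3) g in \<open>auto simp: U_def closed_lists_def Q_def\<close>)
    then show ?thesis using that by (simp add: U_def)
  qed
  \<comment> \<open>Every word of \<open>U\<close> contains \<open>s\<close> exactly once, so
    marking \<open>s\<close> shows that \<open>U\<close> is \<open>n\<close> times as large as its
    part with head \<open>s\<close>.\<close>
  have "(\<Sum>w\<in>U. length (filter ((=) s) w) * 1) = n * (\<Sum>w | w \<in> U \<and> s = hd w. 1)"
    using finU \<open>U \<subseteq> W\<close> lenW rotW rotU by (intro sum_length_filter_rotation) auto
  moreover have "length (filter ((=) s) w) = 1" if "w \<in> U" for w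
    using few[of w] that by (auto simp: U_def Q_def)
  ultimately have cardU: "card U = n * card {w \<in> U. hd w = s}"
    by (simp add: eq_commute[of s])
  have RJ: "3 ^ (16 + e) dvd (\<Sum>w\<in>R J. f w)" for J
  proof (cases "R J = {}")
    case False
    have J0: "J > 0"
    proof (rule ccontr)
      assume "\<not> J > 0"
      then obtain w where w: "w \<in> W" "filter Q w = []" using False by (auto simp: R_def)
      then have "w \<in> closed_lists G (insert g T) n"
        by (auto simp: W_def closed_lists_def filter_empty_conv Q_def)
      then show False using few0[of w] w(2) by simp
    qed
    \<comment> \<open>For \<open>J \<le> 5\<close> the exponent of 3 in \<open>J\<close> is at most
      1; beyond that \<open>three_power_bound\<close> applies.\<close>
    define v where "v = (if J \<le> 5 then 1 else J div 3)"
    show ?thesis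
    proof (rule power_dvd_rotation_sum[where Q = Q and J = J and v = v and n = n])
      show "\<not> 3 ^ Suc v dvd J"
      proof
        assume "3 ^ Suc v dvd J"
        then have "3 ^ Suc v \<le> J" using J0 by (rule dvd_imp_le)
        then show False using three_power_bound[of J] by (auto simp: v_def split: if_splits)
      qed
      fix w assume w: "w \<in> R J"
      then have wW: "w \<in> W" and J: "length (filter Q w) = J" and wU: "w \<notin> U" by (auto simp: R_def)
      have mem: "x \<in># S" if "x \<in> set w" for x using that wW by (auto simp: W_def closed_lists_def)
      show "3 ^ (16 + v) dvd f w"
      proof (cases "J \<le> 5")
        case True
        \<comment> \<open>Otherwise \<open>w\<close> is a word over \<open>g\<close> and
          \<open>T\<close>; having five letters other than \<open>g\<close> it would lie in
          \<open>U\<close>, and fewer are excluded by \<open>few\<close>.\<close>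
        have "\<exists>x\<in>set w. x \<noteq> g \<and> x \<notin> T"
        proof (rule ccontr)
          assume "\<not> ?thesis"
          then have "w \<in> closed_lists G (insert g T) n" using wW by (auto simp: W_def closed_lists_def)
          then show False using few0[of w] wU J True by (auto simp: U_def)
        qed
        then have "3 ^ 20 dvd f w" unfolding f_def using count(2) mem dvd_prod_list_map by metis
        moreover have "(3::nat) ^ (16 + v) dvd 3 ^ 20" using True by (intro le_imp_power_dvd) (simp add: v_def)
        ultimately show ?thesis by (rule dvd_trans[rotated])
      next
        case False
        have "27 ^ length (filter Q w) dvd f w"
          unfolding f_def using count(1) mem by (intro power_dvd_prod_list_filter) (auto simp: Q_def)
        moreover have "(27::nat) ^ J = 3 ^ (3 * J)" by (simp add: power_mult)
        \<comment> \<open>This needs \<open>16 + J div 3 \<le> 3 * J\<close>, which is an equality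
          for \<open>J = 6\<close>.\<close>
        moreover have "(3::nat) ^ (16 + v) dvd 3 ^ (3 * J)"
          using False by (intro le_imp_power_dvd) (simp add: v_def)
        ultimately show ?thesis using J dvd_trans by metis
      qed
      show "rotate1 w \<in> R J" using rotW[OF wW] rotU[OF wW] wU J by (simp add: R_def length_filter_rotate1)
    qed (use n(2) finW lenW fr in \<open>auto simp: R_def\<close>)
  qed simp
  have "(\<Sum>w\<in>W - U. f w) = (\<Sum>J\<le>n. \<Sum>w | w \<in> W - U \<and> length (filter Q w) = J. f w)"
    using finW lenW by (intro sum.group[symmetric]) (auto intro: order_trans[OF length_filter_le])
  also have "\<dots> = (\<Sum>J\<le>n. \<Sum>w\<in>R J. f w)" by (simp add: R_def conj_assoc)
  finally have "3 ^ (16 + e) dvd (\<Sum>w\<in>W - U. f w)" using RJ by (simp add: dvd_sum)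
  moreover have "(\<Sum>w\<in>W. f w) = (\<Sum>w\<in>W - U. f w) + 3 ^ 15 * card U"
    using fU sum.subset_diff[OF \<open>U \<subseteq> W\<close> finW, of f] by (simp add: mult.commute)
  moreover have "card (closed_words G S n) = (\<Sum>w\<in>W. f w)"
    by (simp add: card_closed_words W_def f_def)
  ultimately obtain y where "card (closed_words G S n) = 3 ^ (16 + e) * y + 3 ^ 15 * (n * card {w \<in> U. hd w = s})"
    unfolding cardU by (auto elim: dvdE)
  then have "int (card (closed_words G S n)) - int 3 ^ 15 * int n * int (card {w \<in> U. hd w = s}) =
      int 3 ^ (16 + e) * int y" by simp
  moreover have "{w \<in> U. hd w = s} =
      {w \<in> closed_lists G (insert g T) n. length (filter (\<lambda>x. x \<noteq> g) w) = 5 \<and> hd w = s}"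
    by (auto simp: U_def Q_def)
  ultimately show ?thesis by (simp add: green_series_def)
qed

section \<open>Generators and relators in the special linear group\<close>

definition mat3 :: "int \<Rightarrow> int \<Rightarrow> int \<Rightarrow> int \<Rightarrow> int \<Rightarrow> int \<Rightarrow> int \<Rightarrow> int \<Rightarrow> int \<Rightarrow> int ^ 3 ^ 3" where
  "mat3 a b c d e f g h i = vector [vector [a, b, c], vector [d, e, f], vector [g, h, i]]"

lemma mat3_mult:
  "mat3 a b c d e f g h i ** mat3 a' b' c' d' e' f' g' h' i' =
   mat3 (a * a' + b * d' + c * g') (a * b' + b * e' + c * h') (a * c' + b * f' + c * i')
        (d * a' + e * d' + f * g') (d * b' + e * e' + f * h') (d * c' + e * f' + f * i')
        (g * a' + h * d' + i * g') (g * b' + h * e' + i * h') (g * c' + h * f' + i * i')"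
  by (simp add: mat3_def vec_eq_iff matrix_matrix_mult_def sum_3 forall_3 vector_3)

lemma mat3_one: "mat 1 = mat3 1 0 0 0 1 0 0 0 1"
  by (simp add: mat3_def vec_eq_iff mat_def forall_3 vector_3)

lemma det_mat3: "det (mat3 a b c d e f g h i) =
    a * e * i + b * f * g + c * d * h - a * f * h - b * d * i - c * e * g"
  by (simp add: mat3_def det_3 vector_3)

lemma mat3_eq_iff: "mat3 a b c d e f g h i = mat3 a' b' c' d' e' f' g' h' i' \<longleftrightarrow>
    a = a' \<and> b = b' \<and> c = c' \<and> d = d' \<and> e = e' \<and> f = f' \<and> g = g' \<and> h = h' \<and> i = i'"
  by (simp add: mat3_def vec_eq_iff forall_3 vector_3)

lemma mat3_cases:
  obtains a b c d e f g h i where "A = mat3 a b c d e f g h i"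
proof -
  have "A = mat3 (A$1$1) (A$1$2) (A$1$3) (A$2$1) (A$2$2) (A$2$3) (A$3$1) (A$3$2) (A$3$3)"
    by (simp add: mat3_def vec_eq_iff forall_3 vector_3)
  then show ?thesis by (rule that)
qed

definition perm3 :: "int ^ 3 ^ 3" where "perm3 = mat3 0 0 1 1 0 0 0 1 0"
definition swap3 :: "int ^ 3 ^ 3" where "swap3 = mat3 0 1 0 (-1) 0 0 0 0 1"
definition shear3 :: "int \<Rightarrow> int ^ 3 ^ 3" where "shear3 a = mat3 1 a 0 0 1 0 0 0 1"

lemma SL3Z_simps: "carrier SL3Z = {A. det A = 1}" "\<one>\<^bsub>SL3Z\<^esub> = mat 1" "A \<otimes>\<^bsub>SL3Z\<^esub> B = A ** B"
  by (simp_all add: SL_def)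

lemma SL3Z_inv_eq:
  assumes "A ** B = mat 1" "det A = 1" "det B = 1"
  shows "inv\<^bsub>SL3Z\<^esub> B = A"
  using group.inv_equality[OF group_SL3Z, of A B] assms by (simp add: SL3Z_simps)

section \<open>Generation of the group by Euclidean row reduction\<close>

text \<open>Euclid's algorithm on the column \<open>(a, d)\<close>. \<open>P x y z u\<close> stands
  for membership of the block with rows \<open>(x, y)\<close> and \<open>(z, u)\<close> in a
  subgroup; \<open>step\<close> multiplies it on the right by a quarter turn and a shear, which
  passes from \<open>(a, d)\<close> to \<open>(d, - (a mod d))\<close>.\<close>

lemma block_reduction:
  fixes a d :: int
  assumes one: "P 1 0 0 1"
    and step: "\<And>x y z u q. P x y z u \<Longrightarrow> P (- y) (x + y * q) (- u) (z + u * q)"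
  shows "\<exists>x y z u. P x y z u \<and> z * a + u * d = 0"
proof (induction "nat \<bar>d\<bar>" arbitrary: a d rule: less_induct)
  case less
  show ?case
  proof (cases "d = 0")
    case True
    then show ?thesis using one by (intro exI[of _ 1] exI[of _ 0]) auto
  next
    case False
    then have "nat \<bar>- (a mod d)\<bar> < nat \<bar>d\<bar>" by (simp add: abs_mod_less)
    then obtain x y z u where P: "P x y z u" "z * d + u * (- (a mod d)) = 0"
      using less by blast
    have "- u * a + (z + u * (a div d)) * d = z * d + u * (- (a - (a div d) * d))"
      by (simp add: algebra_simps)
    also have "\<dots> = 0" using P(2) by (simp only: minus_div_mult_eq_mod)
    finally show ?thesis using step[OF P(1), of "a div d"] by blast
  qed
qed

text \<open>Block reductions clear the entries at (3,1), (2,1) and (3,2) in turn. The determinant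
  then forces signs on the diagonal, elementary matrices clear the entries above it, and the
  remaining sign matrices come from the square of \<open>swap3\<close>.\<close>

lemma SL3Z_generated:
  assumes H: "subgroup H SL3Z" and gens: "shear3 1 \<in> H" "perm3 \<in> H" "swap3 \<in> H"
  shows "H = carrier SL3Z"
proof
  show "H \<subseteq> carrier SL3Z" using H by (rule subgroup.subset)
  have mult: "A ** B \<in> H" if "A \<in> H" "B \<in> H" for A B
    using subgroup.m_closed[OF H that] by (simp add: SL3Z_simps)
  have inv: "A \<in> H" if "B \<in> H" "A ** B = mat 1" "det A = 1" for A B
    using subgroup.m_inv_closed[OF H that(1)] SL3Z_inv_eq[OF that(2,3)] that(1) subgroup.subset[OF H]
    by (auto simp: SL3Z_simps)
  have cancel: "A \<in> H" if "B \<in> H" "B ** A \<in> H" "det A = 1" for A B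
  proof -
    interpret group SL3Z by (rule group_SL3Z)
    have c: "B \<in> carrier SL3Z" "A \<in> carrier SL3Z"
      using that subgroup.subset[OF H] by (auto simp: SL3Z_simps)
    have "inv\<^bsub>SL3Z\<^esub> B \<otimes>\<^bsub>SL3Z\<^esub> (B ** A) \<in> H"
      using that subgroup.m_inv_closed[OF H] subgroup.m_closed[OF H] by blast
    also have "inv\<^bsub>SL3Z\<^esub> B \<otimes>\<^bsub>SL3Z\<^esub> (B ** A) = A"
      using c inv_solve_left'[of B] by (simp flip: SL3Z_simps(3) add: m_assoc[symmetric])
    finally show ?thesis .
  qed
  have shear_nat: "shear3 (int n) \<in> H" for n
  proof (induction n)
    case 0
    then show ?case using subgroup.one_closed[OF H] by (simp add: SL3Z_simps shear3_def mat3_one)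
  next
    case (Suc n)
    have "shear3 (int n) ** shear3 1 = shear3 (int (Suc n))" by (simp add: shear3_def mat3_mult)
    then show ?case using mult[OF Suc gens(1)] by simp
  qed
  have shear: "shear3 a \<in> H" for a
  proof (cases "a \<ge> 0")
    case False
    then show ?thesis
      by (intro inv[OF shear_nat[of "nat (- a)"]]) (simp_all add: shear3_def mat3_mult mat3_one det_mat3)
  qed (metis shear_nat nonneg_int_cases)
  have perm': "mat3 0 1 0 0 0 1 1 0 0 \<in> H"
    by (intro inv[OF gens(2)]) (simp_all add: perm3_def mat3_mult mat3_one det_mat3)
  \<comment> \<open>Conjugation by \<open>perm3\<close> shifts both indices of an entry cyclically
    by one.\<close>
  have conj: "mat3 i g h c a b f d e \<in> H" if "mat3 a b c d e f g h i \<in> H" for a b c d e f g h i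
    using mult[OF mult[OF gens(2) that] perm'] by (simp add: perm3_def mat3_mult)
  have E12: "mat3 1 a 0 0 1 0 0 0 1 \<in> H" for a using shear by (simp add: shear3_def)
  have E23: "mat3 1 0 0 0 1 a 0 0 1 \<in> H" for a by (rule conj[OF E12])
  \<comment> \<open>The commutator of the elementary matrices with entry 1 at (1,2) and entry
    \<open>a\<close> at (2,3).\<close>
  have E13: "mat3 1 0 a 0 1 0 0 0 1 \<in> H" for a
    using mult[OF mult[OF mult[OF E12[of 1] E23[of a]] E12[of "-1"]] E23[of "-a"]] by (simp add: mat3_mult)
  have D12: "mat3 (-1) 0 0 0 (-1) 0 0 0 1 \<in> H"
    using mult[OF gens(3) gens(3)] by (simp add: swap3_def mat3_mult)
  have D23: "mat3 1 0 0 0 (-1) 0 0 0 (-1) \<in> H" by (rule conj[OF D12])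
  have D13: "mat3 (-1) 0 0 0 1 0 0 0 (-1) \<in> H" using mult[OF D12 D23] by (simp add: mat3_mult)
  have one: "mat3 1 0 0 0 1 0 0 0 1 \<in> H" using E12[of 0] by simp
  define P where "P x y z u \<longleftrightarrow> mat3 x y 0 z u 0 0 0 1 \<in> H" for x y z u
  have P: "\<exists>x y z u. P x y z u \<and> z * a + u * d = 0" for a d
  proof (rule block_reduction)
    show "P 1 0 0 1" using one by (simp add: P_def)
    show "P (- y) (x + y * q) (- u) (z + u * q)" if "P x y z u" for x y z u q
      using mult[OF mult[OF that[unfolded P_def] gens(3)] E12[of "- q"]]
      by (simp add: P_def swap3_def mat3_mult add.commute)
  qed
  show "carrier SL3Z \<subseteq> H"
  proof
    fix A assume "A \<in> carrier SL3Z"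
    then have detA: "det A = 1" by (simp add: SL3Z_simps)
    obtain a b c d e f g h i where A: "A = mat3 a b c d e f g h i" by (rule mat3_cases)
    obtain x y z u where 1: "P x y z u" "z * d + u * g = 0" using P by blast
    define B1 where "B1 = mat3 1 0 0 0 x y 0 z u"
    have B1: "B1 \<in> H" unfolding B1_def using 1(1) conj by (simp add: P_def)
    define A1 where "A1 = B1 ** A"
    obtain a1 b1 c1 d1 e1 f1 h1 i1 where A1: "A1 = mat3 a1 b1 c1 d1 e1 f1 0 h1 i1"
      using 1(2) by (simp add: A1_def B1_def A mat3_mult)
    obtain x y z u where 2: "P x y z u" "z * a1 + u * d1 = 0" using P by blast
    define B2 where "B2 = mat3 x y 0 z u 0 0 0 1"
    have B2: "B2 \<in> H" unfolding B2_def using 2(1) by (simp add: P_def)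
    define A2 where "A2 = B2 ** A1"
    obtain a2 b2 c2 e2 f2 h2 i2 where A2: "A2 = mat3 a2 b2 c2 0 e2 f2 0 h2 i2"
      using 2(2) by (simp add: A2_def B2_def A1 mat3_mult)
    obtain x y z u where 3: "P x y z u" "z * e2 + u * h2 = 0" using P by blast
    define B3 where "B3 = mat3 1 0 0 0 x y 0 z u"
    have B3: "B3 \<in> H" unfolding B3_def using 3(1) conj by (simp add: P_def)
    define A3 where "A3 = B3 ** A2"
    obtain a3 b3 c3 e3 f3 i3 where A3: "A3 = mat3 a3 b3 c3 0 e3 f3 0 0 i3"
      using 3(2) by (simp add: A3_def B3_def A2 mat3_mult)
    have detH: "det B = 1" if "B \<in> H" for B using that subgroup.subset[OF H] by (auto simp: SL3Z_simps)
    have dets: "det A1 = 1" "det A2 = 1" "det A3 = 1"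
      using detA detH[OF B1] detH[OF B2] detH[OF B3] by (simp_all add: A1_def A2_def A3_def det_mul)
    have prod: "a3 * e3 * i3 = 1" using dets(3) by (simp add: A3 det_mat3)
    then have "\<bar>e3\<bar> = 1" "\<bar>i3\<bar> = 1" "\<bar>a3\<bar> = 1"
      by (metis abs_zmult_eq_1 abs_one mult.commute mult.assoc)+
    then have sq: "e3 * e3 = 1" "i3 * i3 = 1" by (metis abs_mult_self_eq mult_1)+
    \<comment> \<open>As \<open>e3\<close> and \<open>i3\<close> are their own inverses, the upper
      entries can be eliminated over the integers, those of the last column first.\<close>
    define C where "C = mat3 1 (- (b3 * e3)) 0 0 1 0 0 0 1 **
      (mat3 1 0 (- (c3 * i3)) 0 1 0 0 0 1 ** mat3 1 0 0 0 1 (- (f3 * i3)) 0 0 1)"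
    have C: "C \<in> H" unfolding C_def by (intro mult E12 E13 E23)
    have "C ** A3 = mat3 a3 0 0 0 e3 0 0 0 i3"
      using sq by (simp add: C_def A3 mat3_mult mat3_eq_iff algebra_simps)
    moreover have "mat3 a3 0 0 0 e3 0 0 0 i3 \<in> H"
    proof -
      have "a3 = 1 \<or> a3 = -1" "e3 = 1 \<or> e3 = -1" "i3 = 1 \<or> i3 = -1"
        using \<open>\<bar>e3\<bar> = 1\<close> \<open>\<bar>i3\<bar> = 1\<close> \<open>\<bar>a3\<bar> = 1\<close> by linarith+
      then show ?thesis using prod D12 D23 D13 one by auto
    qed
    ultimately have "A3 \<in> H" using cancel[OF C _ dets(3)] by simp
    then have "A2 \<in> H" using cancel[OF B3 _ dets(2)] by (simp add: A3_def)
    then have "A1 \<in> H" using cancel[OF B2 _ dets(1)] by (simp add: A2_def)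
    then show "A \<in> H" using cancel[OF B1 _ detA] by (simp add: A1_def)
  qed
qed

section \<open>Short relations between the letters modulo 3\<close>

datatype letter = S1 | S2 | S3 | S4 | S5

text \<open>The action of \<open>letter_mat k\<close>, introduced below, on column vectors modulo 3.\<close>

fun act :: "letter \<Rightarrow> int \<times> int \<times> int \<Rightarrow> int \<times> int \<times> int" where
  "act S1 (x, y, z) = ((y + z) mod 3, x, y)"
| "act S2 (x, y, z) = ((- y) mod 3, (y - z) mod 3, (x - y + z) mod 3)"
| "act S3 (x, y, z) = ((- z) mod 3, (- x - y) mod 3, (- x) mod 3)"
| "act S4 (x, y, z) = ((2 * y + z) mod 3, (- y) mod 3, x)"
| "act S5 (x, y, z) = ((- x) mod 3, z, (y - z) mod 3)"

definition rotations :: "letter list set" where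
  "rotations = {[S1,S2,S3,S4,S5], [S2,S3,S4,S5,S1], [S3,S4,S5,S1,S2], [S4,S5,S1,S2,S3], [S5,S1,S2,S3,S4]}"

text \<open>The search follows the orbit of the second basis vector; the other two are only looked at
  when it returns.\<close>

fun only_rotations :: "nat \<Rightarrow> letter list \<Rightarrow> int \<times> int \<times> int \<Rightarrow> bool" where
  "only_rotations n w u \<longleftrightarrow>
    (u = (0, 1, 0) \<longrightarrow> w = [] \<or> w \<in> rotations \<or>
      foldr act w (1, 0, 0) \<noteq> (1, 0, 0) \<or> foldr act w (0, 0, 1) \<noteq> (0, 0, 1)) \<and>
    (case n of 0 \<Rightarrow> True | Suc m \<Rightarrow>
      only_rotations m (S1 # w) (act S1 u) \<and> only_rotations m (S2 # w) (act S2 u) \<and>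
      only_rotations m (S3 # w) (act S3 u) \<and> only_rotations m (S4 # w) (act S4 u) \<and>
      only_rotations m (S5 # w) (act S5 u))"

declare only_rotations.simps [simp del]

text \<open>Letters act from the right end of a word, so peeling the last letter off
  \<open>xs\<close> follows one branch of the search.\<close>

lemma only_rotationsD:
  assumes "only_rotations n w u" "length xs \<le> n" "foldr act xs u = (0, 1, 0)"
    "foldr act (xs @ w) (1, 0, 0) = (1, 0, 0)" "foldr act (xs @ w) (0, 0, 1) = (0, 0, 1)"
  shows "xs @ w = [] \<or> xs @ w \<in> rotations"
  using assms
proof (induction n arbitrary: xs w u)
  case 0
  then show ?case by (auto simp: only_rotations.simps[of 0])
next
  case (Suc n)
  show ?case
  proof (cases xs rule: rev_cases)
    case Nil
    then show ?thesis using Suc.prems by (auto simp: only_rotations.simps[of "Suc n"])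
  next
    case (snoc ys k)
    have "only_rotations n (k # w) (act k u)"
      using Suc.prems(1) by (cases k) (auto simp: only_rotations.simps[of "Suc n"])
    then show ?thesis using Suc.IH[of "k # w" "act k u" ys] Suc.prems snoc by simp
  qed
qed

text \<open>Exhaustive evaluation over the 3906 words of length at most 5; writing 5 with
  \<open>Suc\<close> lets the case distinction unfold.\<close>

lemma only_rotations_5: "only_rotations (Suc (Suc (Suc (Suc (Suc 0))))) [] (0, 1, 0)"
  by (simp add: rotations_def only_rotations.simps)

text \<open>\<open>letter_mat Sk\<close> is \<open>P\<^sub>k\<^sub>-\<^sub>1\<inverse> P\<^sub>k\<close> with \<open>P\<^sub>0 = P\<^sub>5 = 1\<close>, where \<open>P\<^sub>1, \<dots>, P\<^sub>4\<close> conjugate \<open>shear3 a\<close> into the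
  elementary matrices with entry \<open>a, -a, -a, -a\<close> at position \<open>(2,3), (1,2), (2,3), (1,3)\<close>.
  This leaves a factor from the centralizer of \<open>shear3 a\<close> free in each \<open>P\<^sub>k\<close>; these factors were
  found by a computer search, so that \<open>only_rotations_5\<close> holds.\<close>

fun letter_mat :: "letter \<Rightarrow> int ^ 3 ^ 3" where
  "letter_mat S1 = mat3 0 1 1 1 0 0 0 1 0"
| "letter_mat S2 = mat3 0 (-1) 0 0 1 (-1) 1 (-1) 1"
| "letter_mat S3 = mat3 0 0 (-1) (-1) (-1) 0 (-1) 0 0"
| "letter_mat S4 = mat3 0 2 1 0 (-1) 0 1 0 0"
| "letter_mat S5 = mat3 (-1) 0 0 0 0 1 0 1 (-1)"

declare letter_mat.simps [simp del]

text \<open>The term \<open>b * c\<close> comes from multiplying the factor with entry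
  \<open>- b\<close> at (1,2) by the later one with entry \<open>- c\<close> at (2,3).\<close>

lemma relator_value:
  "letter_mat S1 ** (shear3 a ** (letter_mat S2 ** (shear3 b ** (letter_mat S3 ** (shear3 c **
    (letter_mat S4 ** (shear3 d ** (letter_mat S5 ** shear3 e)))))))) =
   mat3 1 (e - b) (b * c - d) 0 1 (a - c) 0 0 1"
  by (simp add: letter_mat.simps shear3_def mat3_mult mat3_eq_iff algebra_simps)

lemma letter_mat_neq_shear [simp]: "letter_mat k \<noteq> shear3 a"
  by (cases k) (auto simp: letter_mat.simps shear3_def mat3_eq_iff)

lemma letter_mat_eq_iff [simp]: "letter_mat k = letter_mat l \<longleftrightarrow> k = l"
  by (cases k; cases l) (auto simp: letter_mat.simps mat3_eq_iff)

definition column_mod3 :: "int ^ 3 ^ 3 \<Rightarrow> 3 \<Rightarrow> int \<times> int \<times> int" where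
  "column_mod3 A j = (A$1$j mod 3, A$2$j mod 3, A$3$j mod 3)"

lemma column_mod3_letter: "column_mod3 (letter_mat k ** A) j = act k (column_mod3 A j)"
  by (cases k; simp add: letter_mat.simps column_mod3_def mat3_def matrix_matrix_mult_def sum_3 mod_simps; presburger?)

lemma column_mod3_shear: "column_mod3 (shear3 3 ** A) j = column_mod3 A j"
  by (simp add: column_mod3_def shear3_def mat3_def matrix_matrix_mult_def sum_3 mod_simps)

lemma SL3Z_mult_eq: "(\<otimes>\<^bsub>SL3Z\<^esub>) = (**)" and SL3Z_one_eq: "\<one>\<^bsub>SL3Z\<^esub> = mat 1"
  by (simp_all add: SL_def)

abbreviation alphabet :: "(int ^ 3 ^ 3) set" where
  "alphabet \<equiv> insert (shear3 3) (range letter_mat)"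

text \<open>\<open>shear3 3\<close> is the identity modulo 3, so only the other letters act on the
  columns.\<close>

lemma column_mod3_word:
  assumes "set w \<subseteq> alphabet"
  shows "\<exists>ks. filter (\<lambda>x. x \<noteq> shear3 3) w = map letter_mat ks \<and>
    (\<forall>j. column_mod3 (foldr (**) w (mat 1)) j = foldr act ks (column_mod3 (mat 1) j))"
  using assms
proof (induction w)
  case (Cons x w)
  then obtain ks where ks: "filter (\<lambda>x. x \<noteq> shear3 3) w = map letter_mat ks"
    "\<And>j. column_mod3 (foldr (**) w (mat 1)) j = foldr act ks (column_mod3 (mat 1) j)" by auto
  consider "x = shear3 3" | k where "x = letter_mat k" using Cons.prems by auto
  then show ?case
  proof cases
    case 1
    then show ?thesis using ks by (intro exI[of _ ks]) (simp add: column_mod3_shear)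
  next
    case (2 k)
    then show ?thesis using ks
      by (intro exI[of _ "k # ks"]) (simp add: column_mod3_letter)
  qed
qed auto

lemma foldr_replicate_shear: "foldr (**) (replicate n (shear3 3)) A = shear3 (3 * int n) ** A"
proof (induction n)
  case 0
  then show ?case by (simp add: shear3_def mat3_one[symmetric])
next
  case (Suc n)
  have "shear3 3 ** shear3 (3 * int n) = shear3 (3 * int (Suc n))"
    by (simp add: shear3_def mat3_mult mat3_eq_iff)
  then show ?case by (simp add: Suc matrix_mul_assoc del: foldr_replicate)
qed

text \<open>Modulo 3 the word acts trivially, so the search leaves a rotation or the empty word. The
  latter would make a positive power of \<open>shear3 3\<close> trivial, but this matrix has
  infinite order.\<close>

lemma closed_word_letters:
  assumes w: "w \<in> closed_lists SL3Z alphabet n" and n: "n > 0"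
    and few: "length (filter (\<lambda>x. x \<noteq> shear3 3) w) \<le> 5"
  shows "\<exists>ks\<in>rotations. filter (\<lambda>x. x \<noteq> shear3 3) w = map letter_mat ks"
proof -
  have set: "set w \<subseteq> alphabet" and len: "length w = n" and eq: "foldr (**) w (mat 1) = mat 1"
    using w by (auto simp: closed_lists_def SL3Z_mult_eq SL3Z_one_eq)
  obtain ks where ks: "filter (\<lambda>x. x \<noteq> shear3 3) w = map letter_mat ks"
    "\<And>j. column_mod3 (mat 1) j = foldr act ks (column_mod3 (mat 1) j)"
    using column_mod3_word[OF set] eq by auto
  have cols: "column_mod3 (mat 1) 1 = (1, 0, 0)" "column_mod3 (mat 1) 2 = (0, 1, 0)"
    "column_mod3 (mat 1) 3 = (0, 0, 1)"
    by (simp_all add: column_mod3_def mat_def)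
  have "length ks \<le> 5" using few ks(1) by simp
  then have "ks @ [] = [] \<or> ks @ [] \<in> rotations"
    using ks(2)[of 1] ks(2)[of 2] ks(2)[of 3]
    by (intro only_rotationsD[OF only_rotations_5]) (simp_all add: cols)
  moreover have "ks \<noteq> []"
  proof
    assume "ks = []"
    then have "\<forall>x\<in>set w. x = shear3 3" using ks(1) by (simp add: filter_empty_conv)
    then have "w = replicate n (shear3 3)" using len by (simp add: replicate_eqI)
    then have "shear3 (3 * int n) = mat 1" using eq foldr_replicate_shear[of n "mat 1"] by (simp del: foldr_replicate)
    then show False using n by (simp add: shear3_def mat3_one mat3_eq_iff)
  qed
  ultimately show ?thesis using ks(1) by auto
qed

lemma filter_neq_eq_ConsE:
  assumes "filter (\<lambda>x. x \<noteq> g) w = y # ys"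
  obtains a w' where "w = replicate a g @ y # w'" "filter (\<lambda>x. x \<noteq> g) w' = ys" "y \<noteq> g"
proof -
  obtain us w' where w: "w = us @ y # w'" "\<forall>u\<in>set us. u = g" "y \<noteq> g" "ys = filter (\<lambda>x. x \<noteq> g) w'"
    using assms by (auto simp: filter_eq_Cons_iff)
  then have "us = replicate (length us) g" by (simp add: replicate_eqI)
  then show ?thesis using that w by metis
qed

lemma replicate_append_Cons_eq:
  assumes "replicate a g @ y # u = replicate b g @ z # v" "y \<noteq> g" "z \<noteq> g"
  shows "a = b \<and> u = v"
  using assms
proof (induction a arbitrary: b)
  case 0
  then show ?case by (cases b) auto
next
  case (Suc a)
  then show ?case by (cases b) auto
qed

section \<open>Counting the relators of a given length\<close>

definition relator :: "nat \<Rightarrow> nat \<Rightarrow> nat \<Rightarrow> nat \<Rightarrow> nat \<Rightarrow> (int ^ 3 ^ 3) list" where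
  "relator a b c d e = letter_mat S1 # replicate a (shear3 3) @ letter_mat S2 # replicate b (shear3 3) @
    letter_mat S3 # replicate c (shear3 3) @ letter_mat S4 # replicate d (shear3 3) @
    letter_mat S5 # replicate e (shear3 3)"

text \<open>Each exponent enters \<open>relator_value\<close> multiplied by 3, so the corner entry
  is \<open>9 * b * c - 3 * d\<close>; hence the coefficient 3 of the product term in
  \<open>box_count\<close>.\<close>

lemma relator_eq_one_iff:
  "foldr (**) (relator a b c d e) (mat 1) = mat 1 \<longleftrightarrow> a = c \<and> b = e \<and> d = 3 * b * c"
proof -
  have "foldr (**) (relator a b c d e) (mat 1) = mat3 1 (3 * int e - 3 * int b)
      (3 * int b * (3 * int c) - 3 * int d) 0 1 (3 * int a - 3 * int c) 0 0 1"
    by (simp add: relator_def foldr_replicate_shear relator_value matrix_mul_rid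
        del: foldr_replicate)
  moreover have "3 * int b * (3 * int c) - 3 * int d = 0 \<longleftrightarrow> d = 3 * b * c"
  proof -
    have "3 * int b * (3 * int c) - 3 * int d = 3 * (int (3 * b * c) - int d)" by simp
    then show ?thesis by (auto simp del: of_nat_mult)
  qed
  ultimately show ?thesis by (auto simp: mat3_one mat3_eq_iff)
qed

text \<open>Only one of the five rotations begins with \<open>S1\<close>, so these words are
  relators. Triviality leaves two free exponents, which can be read off the word.\<close>

lemma card_relators:
  assumes n: "n > 0"
  shows "card {w \<in> closed_lists SL3Z alphabet n.
      length (filter (\<lambda>x. x \<noteq> shear3 3) w) = 5 \<and> hd w = letter_mat S1} = box_count n"
    (is "card ?W = _")
proof -
  let ?P = "{(i, j). 2 * i + 2 * j + 3 * i * j + 5 = n}"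
  define \<phi> where "\<phi> = (\<lambda>(i, j). relator i j i (3 * j * i) j)"
  have len: "length (relator a b c d e) = a + b + c + d + e + 5" for a b c d e
    by (simp add: relator_def)
  have "?W = \<phi> ` ?P"
  proof (intro equalityI subsetI)
    fix w assume "w \<in> ?W"
    then have w: "w \<in> closed_lists SL3Z alphabet n" "hd w = letter_mat S1"
      "length (filter (\<lambda>x. x \<noteq> shear3 3) w) = 5" by auto
    obtain ks where ks: "ks \<in> rotations" "filter (\<lambda>x. x \<noteq> shear3 3) w = map letter_mat ks"
      using closed_word_letters[OF w(1) n] w(3) by auto
    obtain v where v: "w = letter_mat S1 # v" using w(1,2) n by (cases w) (auto simp: closed_lists_def)
    have "hd ks = S1" using ks v by (cases ks) auto
    then have "ks = [S1, S2, S3, S4, S5]" using ks(1) by (auto simp: rotations_def)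
    then have "filter (\<lambda>x. x \<noteq> shear3 3) v = [letter_mat S2, letter_mat S3, letter_mat S4, letter_mat S5]"
      using ks(2) v by simp
    then obtain a b c d u where "v = replicate a (shear3 3) @ letter_mat S2 # replicate b (shear3 3) @
        letter_mat S3 # replicate c (shear3 3) @ letter_mat S4 # replicate d (shear3 3) @ letter_mat S5 # u"
      "filter (\<lambda>x. x \<noteq> shear3 3) u = []"
      by (elim filter_neq_eq_ConsE) blast
    moreover from this(2) have "u = replicate (length u) (shear3 3)"
      by (simp add: filter_empty_conv replicate_eqI)
    ultimately have wr: "w = relator a b c d (length u)" unfolding v relator_def by metis
    have "foldr (**) w (mat 1) = mat 1" "length w = n"
      using w(1) by (auto simp: closed_lists_def SL3Z_mult_eq SL3Z_one_eq)
    then have "w = \<phi> (a, b)" "(a, b) \<in> ?P"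
      unfolding wr relator_eq_one_iff len by (auto simp: \<phi>_def)
    then show "w \<in> \<phi> ` ?P" by blast
  next
    fix w assume "w \<in> \<phi> ` ?P"
    then obtain i j where ij: "2 * i + 2 * j + 3 * i * j + 5 = n" and w: "w = relator i j i (3 * j * i) j"
      by (auto simp: \<phi>_def)
    have "length w = n" using ij by (simp add: w len ac_simps)
    moreover have "foldr (**) w (mat 1) = mat 1" unfolding w relator_eq_one_iff by simp
    moreover have "set w \<subseteq> alphabet" by (auto simp: w relator_def)
    moreover have "hd w = letter_mat S1" by (simp add: w relator_def)
    moreover have "length (filter (\<lambda>x. x \<noteq> shear3 3) w) = 5"
      by (simp add: w relator_def)
    ultimately show "w \<in> ?W" by (simp add: closed_lists_def SL3Z_mult_eq SL3Z_one_eq)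
  qed
  moreover have "inj_on \<phi> ?P"
  proof (rule inj_onI)
    fix x y assume eq: "\<phi> x = \<phi> y"
    obtain i j i' j' where x: "x = (i, j)" and y: "y = (i', j')" by fastforce
    show "x = y"
      using eq letter_mat_neq_shear unfolding x y \<phi>_def relator_def prod.case
      by (metis (no_types, lifting) list.inject replicate_append_Cons_eq)
  qed
  ultimately show ?thesis by (simp add: card_image box_count_def)
qed

section \<open>The generating multiset and its Green series\<close>

definition generators :: "(int ^ 3 ^ 3) multiset" where
  "generators = {#shear3 3#} + repeat_mset 27 (mset (map letter_mat [S1, S2, S3, S4, S5])) +
    repeat_mset (3 ^ 20) {#shear3 1, perm3, swap3#}"

lemma UNIV_letter: "UNIV = {S1, S2, S3, S4, S5}"
  using letter.exhaust by auto

lemma set_generators: "set_mset generators = alphabet \<union> {shear3 1, perm3, swap3}"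
  by (auto simp: generators_def UNIV_letter)

lemma generators_SL3Z: "set_mset generators \<subseteq> carrier SL3Z"
proof -
  have "det (letter_mat k) = 1" for k by (cases k) (simp_all add: letter_mat.simps det_mat3)
  then show ?thesis
    by (auto simp: set_generators SL3Z_simps shear3_def perm3_def swap3_def det_mat3)
qed

lemma generating_generators: "generating_mset SL3Z generators"
proof -
  interpret group SL3Z by (rule group_SL3Z)
  have "generate SL3Z (set_mset generators) = carrier SL3Z"
    by (intro SL3Z_generated generate_is_subgroup generators_SL3Z generate.incl)
      (auto simp: set_generators)
  then show ?thesis using generators_SL3Z by (simp add: generating_mset_def)
qed

lemma count_generators_shear: "count generators (shear3 3) = 1"
  by (simp add: generators_def letter_mat.simps shear3_def perm3_def swap3_def mat3_eq_iff)

lemma count_generators_letter: "count generators (letter_mat k) = 27"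
  by (cases k) (simp_all add: generators_def letter_mat.simps shear3_def perm3_def swap3_def mat3_eq_iff)

lemma count_generators_rest:
  assumes "x \<in># generators" "x \<notin> alphabet"
  shows "3 ^ 20 dvd count generators x"
proof -
  have "x = shear3 1 \<or> x = perm3 \<or> x = swap3" using assms by (auto simp: set_generators)
  then show ?thesis
    by (elim disjE) (simp_all add: generators_def letter_mat.simps shear3_def perm3_def swap3_def mat3_eq_iff)
qed

theorem corollary2:
  "\<exists>S :: (int ^ 3 ^ 3) multiset.
     generating_mset SL3Z S \<and> \<not> D_finite (green_series SL3Z S)"
proof (intro exI[of _ generators] conjI generating_generators)
  interpret group SL3Z by (rule group_SL3Z)
  show "\<not> D_finite (green_series SL3Z generators)"
  \<comment> \<open>The exponent 15 comes from \<open>27 ^ 5 = 3 ^ 15\<close>, the weight of a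
    relator.\<close>
  proof (rule not_D_finite_by_congruences[where q = 3 and m = 15 and K = box_count])
    fix n e :: nat assume n: "n > 0" "3 ^ e dvd n"
    have "int 3 ^ (15 + 1 + e) dvd fps_nth (green_series SL3Z generators) n - int 3 ^ 15 * int n *
      int (card {w \<in> closed_lists SL3Z alphabet n.
        length (filter (\<lambda>x. x \<noteq> shear3 3) w) = 5 \<and> hd w = letter_mat S1})"
    proof (rule green_series_cong[OF generators_SL3Z _ _ count_generators_shear _ _ _ _ n])
      show "alphabet \<subseteq> set_mset generators" by (auto simp: set_generators)
      show "shear3 3 \<notin> range letter_mat" using letter_mat_neq_shear by (metis imageE)
      show "27 dvd count generators x" if "x \<in># generators" "x \<noteq> shear3 3" for x
      proof (cases "x \<in> range letter_mat")
        case False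
        have "(27::nat) dvd 3 ^ 20" by simp
        then show ?thesis using count_generators_rest[of x] that False dvd_trans by blast
      qed (auto simp: count_generators_letter)
      show "3 ^ 20 dvd count generators x"
        if "x \<in># generators" "x \<noteq> shear3 3" "x \<notin> range letter_mat" for x
        using that by (intro count_generators_rest) auto
      show "count generators x = 27" if "x \<in> range letter_mat" for x
        using that by (auto simp: count_generators_letter)
      fix w assume "w \<in> closed_lists SL3Z alphabet n"
        "length (filter (\<lambda>x. x \<noteq> shear3 3) w) \<le> 5"
      then obtain ks where ks: "ks \<in> rotations" "filter (\<lambda>x. x \<noteq> shear3 3) w = map letter_mat ks"
        using closed_word_letters n(1) by blast
      \<comment> \<open>\<open>letter_mat S1\<close> differs from \<open>shear3 3\<close>, so its
        occurrences can be counted in the rotation \<open>ks\<close>, where \<open>S1\<close>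
        appears once.\<close>
      have "filter ((=) (letter_mat S1)) w = filter ((=) (letter_mat S1)) (filter (\<lambda>x. x \<noteq> shear3 3) w)"
        by (auto intro!: filter_cong)
      also have "\<dots> = map letter_mat (filter ((=) S1) ks)"
        by (simp add: ks(2) filter_map o_def)
      finally show "length (filter (\<lambda>x. x \<noteq> shear3 3) w) = 5 \<and>
          length (filter ((=) (letter_mat S1)) w) = 1"
        using ks by (auto simp: rotations_def)
    qed
    then show "int 3 ^ (15 + 1 + e) dvd fps_nth (green_series SL3Z generators) n -
        int 3 ^ 15 * int n * int (box_count n)"
      using card_relators[OF n(1)] by simp
  next
    fix n0 V k j :: nat assume "j \<le> k"
    from box_count_isolated[OF this, of "Suc k" n0 V]
    show "\<exists>n>k. [n = n0] (mod 3 ^ V) \<and> \<not> 3 dvd box_count (n - j) \<and>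
      (\<forall>i\<le>k. i \<noteq> j \<longrightarrow> 3 dvd box_count (n - i))" by (simp add: Suc_le_eq)
  qed simp
qed


end
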